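(* Let $K$ be a number field and let $X$ be a K3 surface of degree 2 over $K$. Then there is a field extension $L/K$ with $[L:K]\leq 12$ such that the set $X(L)$ of $L$-rational points of $X$ is infinite.
   Context: A K3 surface of degree 2 over a field $k$ is a double cover of $\mathbb{P}^2_k$ branched along a smooth sextic curve; equivalently, a hypersurface in the weighted projective space $\mathbb{P}(1,1,1,3)=\operatorname{Proj} k[x,y,z,w]$ given by $w^2=f(x,y,z)$, where $f\in k[x,y,z]$ is homogeneous of degree 6 and the plane curve $V(f)\subset\mathbb{P}^2_k$ is smooth. *)

theory Defs
  imports
    "HOL-Algebra.Algebraic_Closure_Type"
    "HOL-Library.Poly_Mapping"
    "HOL-Library.Product_Plus"
begin

text \<open>
  The base field is a type \<open>'a\<close>. Its finite extensions are represented by the intermediate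
  fields of the algebraic closure \<open>'a alg_closure\<close>, in which \<open>'a\<close> is embedded by
  \<^const>\<open>to_ac\<close>; up to isomorphism over \<open>'a\<close> these are all of them.
\<close>

definition number_field :: "'a :: field_char_0 itself \<Rightarrow> bool" where
  "number_field _ \<longleftrightarrow>
     ring.finite_dimension (ring_of_type_algebra :: 'a ring) (range of_rat) UNIV"

definition finite_extension :: "'a :: field alg_closure set \<Rightarrow> bool" where
  "finite_extension L \<longleftrightarrow>
     subfield L ring_of_type_algebra \<and> range to_ac \<subseteq> L \<and>
     ring.finite_dimension ring_of_type_algebra (range to_ac) L"

definition ext_degree :: "'a :: field alg_closure set \<Rightarrow> nat" where
  "ext_degree L = ring.dim ring_of_type_algebra (range to_ac) L"

text \<open>
  Polynomials in \<open>x, y, z\<close>: the key \<open>(i, j, k)\<close> stands for the monomial \<open>x\<^sup>i y\<^sup>j z\<^sup>k\<close>, so that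
  with the componentwise addition of triples the product is that of polynomials.
\<close>

type_synonym 'a poly3 = "(nat \<times> nat \<times> nat) \<Rightarrow>\<^sub>0 'a"

definition homogeneous3 :: "nat \<Rightarrow> 'a :: zero poly3 \<Rightarrow> bool" where
  "homogeneous3 d f \<longleftrightarrow> (\<forall>(i, j, k) \<in> Poly_Mapping.keys f. i + j + k = d)"

definition eval3 ::
  "'a :: field poly3 \<Rightarrow> 'a alg_closure \<Rightarrow> 'a alg_closure \<Rightarrow> 'a alg_closure \<Rightarrow> 'a alg_closure" where
  "eval3 f x y z =
     (\<Sum>(i, j, k) \<in> Poly_Mapping.keys f.
        to_ac (Poly_Mapping.lookup f (i, j, k)) * x ^ i * y ^ j * z ^ k)"

text \<open>In the partial derivatives, truncated subtraction only affects terms with coefficient 0.\<close>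

definition pderiv_x :: "'a :: comm_semiring_1 poly3 \<Rightarrow> 'a poly3" where
  "pderiv_x f = (\<Sum>(i, j, k) \<in> Poly_Mapping.keys f.
     Poly_Mapping.single (i - 1, j, k) (of_nat i * Poly_Mapping.lookup f (i, j, k)))"

definition pderiv_y :: "'a :: comm_semiring_1 poly3 \<Rightarrow> 'a poly3" where
  "pderiv_y f = (\<Sum>(i, j, k) \<in> Poly_Mapping.keys f.
     Poly_Mapping.single (i, j - 1, k) (of_nat j * Poly_Mapping.lookup f (i, j, k)))"

definition pderiv_z :: "'a :: comm_semiring_1 poly3 \<Rightarrow> 'a poly3" where
  "pderiv_z f = (\<Sum>(i, j, k) \<in> Poly_Mapping.keys f.
     Poly_Mapping.single (i, j, k - 1) (of_nat k * Poly_Mapping.lookup f (i, j, k)))"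

text \<open>
  Smoothness over a field is a condition on the geometric points, i.e. those over the algebraic
  closure. It fails for \<open>f = 0\<close>.
\<close>

definition smooth_plane_curve :: "'a :: field poly3 \<Rightarrow> bool" where
  "smooth_plane_curve f \<longleftrightarrow>
     (\<forall>x y z. (x, y, z) \<noteq> (0, 0, 0) \<and> eval3 f x y z = 0 \<longrightarrow>
        eval3 (pderiv_x f) x y z \<noteq> 0 \<or>
        eval3 (pderiv_y f) x y z \<noteq> 0 \<or>
        eval3 (pderiv_z f) x y z \<noteq> 0)"

text \<open>
  \<open>degree2_K3 f\<close> says that \<open>w\<^sup>2 = f(x, y, z)\<close> defines a K3 surface of degree 2 in
  \<open>\<bbbP>(1,1,1,3)\<close>.
\<close>

definition degree2_K3 :: "'a :: field poly3 \<Rightarrow> bool" where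
  "degree2_K3 f \<longleftrightarrow> homogeneous3 6 f \<and> smooth_plane_curve f"

text \<open>
  The \<open>L\<close>-rational points of the surface are the classes of nonzero solutions in \<open>L\<close> under the
  action of \<open>L\<^sup>*\<close> with weights \<open>(1,1,1,3)\<close>. The only point of \<open>\<bbbP>(1,1,1,3)\<close> where such
  classes and rational points differ is \<open>[0:0:0:1]\<close>, where the action has nontrivial
  stabilizers; it does not lie on the surface.
\<close>

definition wproj_rel :: "'b :: field set \<Rightarrow> (('b \<times> 'b \<times> 'b \<times> 'b) \<times> ('b \<times> 'b \<times> 'b \<times> 'b)) set" where
  "wproj_rel L =
     {((x, y, z, w), (c * x, c * y, c * z, c ^ 3 * w)) | x y z w c.
        x \<in> L \<and> y \<in> L \<and> z \<in> L \<and> w \<in> L \<and> (x, y, z, w) \<noteq> (0, 0, 0, 0) \<and> c \<in> L \<and> c \<noteq> 0}"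

definition rational_points ::
  "'a :: field poly3 \<Rightarrow> 'a alg_closure set \<Rightarrow>
    ('a alg_closure \<times> 'a alg_closure \<times> 'a alg_closure \<times> 'a alg_closure) set set" where
  "rational_points f L =
     {(x, y, z, w). x \<in> L \<and> y \<in> L \<and> z \<in> L \<and> w \<in> L \<and>
        (x, y, z, w) \<noteq> (0, 0, 0, 0) \<and> w ^ 2 = eval3 f x y z} // wproj_rel L"

end

theory Submission
  imports Defs
begin

text \<open>
  A point \<open>P\<close> of the branch sextic on a rational line has degree at most 6 over the base field. On
  the tangent line at \<open>P\<close> the sextic becomes \<open>s\<^sup>2 g(s)\<close> with a nonzero quartic \<open>g\<close>, so the surface
  contains a curve birational to \<open>v\<^sup>2 = g(s)\<close>, and a value \<open>t\<close> of \<open>s\<close> gives a point on it after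
  adjoining a square root of \<open>g(t)\<close>. If \<open>g\<close> has a multiple root, its resolvent cubic defines a
  rational curve and there is nothing more to do. Otherwise the point generates infinitely many
  others by doubling on the Jacobian, the resolvent cubic, unless it is torsion.

  To find \<open>t\<close> for which it is not torsion, take two rational values \<open>t\<^sub>1, t\<^sub>2\<close> that are close to each
  other in a valuation ring above 2. The difference of the two points is then close to the origin,
  where doubling multiplies the size of the \<open>x\<close>-coordinate by \<open>|1/4| > 1\<close>. So the difference has
  infinite order, and at least one of the two points has infinite order as well.
\<close>

section \<open>Subrings and valuation rings\<close>

text \<open>In general \<open>g\<close> splits into two quadratics only over the algebraic closure,
  and so does the 2-torsion point that puts the Jacobian in the form
  \<open>y^2 = x (x^2 + a x + b)\<close>. Infinite order is therefore proved over the closure, with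
  a valuation ring of the whole closure. Only then is the orbit moved into \<open>L\<close>: adding
  a root \<open>r\<close> of the resolvent cubic leads to a model with coefficients in
  \<open>L\<close>.

  The points over \<open>t1\<close> and \<open>t2\<close> involve square roots of different values
  of \<open>g\<close>. Their difference lives in a larger field and only serves to show that one of
  them has infinite order; that one square root is adjoined, which gives 12 = 6 * 2.

  The point of the Jacobian attached to \<open>t\<close> is the difference of the two points of the
  quartic over \<open>t\<close>. As square roots are known up to sign, only
  \<open>x\<close>-coordinates are tracked, and a relation that does not tell a sum from a
  difference replaces the group law.

  Doubling is split into two 2-isogenies, which have short formulas on \<open>x\<close>-coordinates
  and preserve the size of large ones. Its growth comes from the rescaling by 1/4 alone, which is
  why the prime is 2.\<close>

definition is_subring :: "'b :: field set \<Rightarrow> bool" where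
  "is_subring A \<longleftrightarrow> 1 \<in> A \<and> (\<forall>x\<in>A. \<forall>y\<in>A. x - y \<in> A \<and> x * y \<in> A)"

lemma is_subringD:
  assumes "is_subring A"
  shows "1 \<in> A" "0 \<in> A" "x \<in> A \<Longrightarrow> - x \<in> A" "x \<in> A \<Longrightarrow> y \<in> A \<Longrightarrow> x - y \<in> A"
    "x \<in> A \<Longrightarrow> y \<in> A \<Longrightarrow> x + y \<in> A" "x \<in> A \<Longrightarrow> y \<in> A \<Longrightarrow> x * y \<in> A"
proof -
  show 1: "1 \<in> A" and d: "x \<in> A \<Longrightarrow> y \<in> A \<Longrightarrow> x - y \<in> A" and "x \<in> A \<Longrightarrow> y \<in> A \<Longrightarrow> x * y \<in> A" for x y
    using assms by (auto simp: is_subring_def)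
  show 0: "0 \<in> A" using d[OF 1 1] by simp
  show m: "x \<in> A \<Longrightarrow> - x \<in> A" for x using d[OF 0, of x] by simp
  show "x \<in> A \<Longrightarrow> y \<in> A \<Longrightarrow> x + y \<in> A" using d[OF _ m, of x y] by simp
qed

lemma is_subring_power: "is_subring A \<Longrightarrow> x \<in> A \<Longrightarrow> x ^ n \<in> A"
  by (induction n) (auto intro: is_subringD)

lemma is_subring_sum: "is_subring A \<Longrightarrow> (\<And>i. i \<in> I \<Longrightarrow> h i \<in> A) \<Longrightarrow> sum h I \<in> A"
  by (induction I rule: infinite_finite_induct) (auto intro: is_subringD)

lemma is_subring_of_nat: "is_subring A \<Longrightarrow> of_nat n \<in> A"
  by (induction n) (auto intro: is_subringD)

lemma is_subring_numeral: "is_subring A \<Longrightarrow> numeral n \<in> A"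
  using is_subring_of_nat[of A "numeral n"] by simp

lemma is_subring_adjoin:
  fixes A :: "'b :: field set"
  assumes "is_subring A"
  defines "B \<equiv> \<lambda>x. {poly p x | p. \<forall>i. Polynomial.coeff p i \<in> A}"
  shows "is_subring (B x)" "A \<subseteq> B x" "x \<in> B x"
proof -
  note A = is_subringD[OF assms(1)] is_subring_sum[OF assms(1)]
  show "A \<subseteq> B x"
  proof
    fix c assume "c \<in> A"
    thus "c \<in> B x" unfolding B_def using A
      by (intro CollectI exI[of _ "[:c:]"]) (auto simp: coeff_pCons split: nat.splits)
  qed
  then have "1 \<in> B x" using A by auto
  moreover have "poly p x - poly q x \<in> B x \<and> poly p x * poly q x \<in> B x"
    if "\<forall>i. Polynomial.coeff p i \<in> A" "\<forall>i. Polynomial.coeff q i \<in> A" for p q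
  proof
    show "poly p x - poly q x \<in> B x" unfolding B_def using that A
      by (intro CollectI exI[of _ "p - q"]) auto
    have "Polynomial.coeff (p * q) i \<in> A" for i
      unfolding coeff_mult using that by (intro A) auto
    then show "poly p x * poly q x \<in> B x" unfolding B_def
      by (intro CollectI exI[of _ "p * q"]) auto
  qed
  ultimately show "is_subring (B x)"
    unfolding is_subring_def B_def by blast
  show "x \<in> B x" unfolding B_def using A
    by (intro CollectI exI[of _ "[:0,1:]"]) (auto simp: coeff_pCons split: nat.splits)
qed

lemma poly_inverse_mult_power_mem:
  fixes w :: "'b :: field"
  assumes "is_subring A" "\<forall>i. Polynomial.coeff p i \<in> A" "w \<in> A" "w \<noteq> 0" "Polynomial.degree p \<le> n"
  shows "w ^ n * poly p (inverse w) \<in> A"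
proof -
  have "w ^ n * poly p (inverse w) = (\<Sum>i\<le>Polynomial.degree p. Polynomial.coeff p i * w ^ (n - i))"
    unfolding poly_altdef sum_distrib_left
  proof (rule sum.cong)
    fix i assume "i \<in> {..Polynomial.degree p}"
    then have "w ^ n = w ^ (n - i) * w ^ i" using assms(5) by (simp flip: power_add)
    then show "w ^ n * (Polynomial.coeff p i * inverse w ^ i) = Polynomial.coeff p i * w ^ (n - i)"
      using assms(4) by (simp add: field_simps)
  qed simp
  also have "\<dots> \<in> A"
    using assms by (intro is_subring_sum is_subringD(6) is_subring_power) auto
  finally show ?thesis .
qed

text \<open>Chevalley's argument. If neither \<open>x\<close> nor its inverse lies in
  \<open>A\<close>, adjoining either of them reaches 1/2 by maximality, and two such relations of
  minimal degree can be combined to lower one of the degrees.\<close>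

lemma maximal_subring_valuation:
  fixes A :: "'b :: field_char_0 set"
  assumes A: "is_subring A" and half: "inverse 2 \<notin> A"
    and max: "\<And>B. is_subring B \<Longrightarrow> A \<subseteq> B \<Longrightarrow> inverse 2 \<notin> B \<Longrightarrow> B = A"
  shows "x \<in> A \<or> inverse x \<in> A"
proof -
  note Ad = is_subringD[OF A]
  have half_poly: "\<exists>p. (\<forall>i. Polynomial.coeff p i \<in> A) \<and> poly p x = inverse 2" if "x \<notin> A" for x
  proof -
    define B where "B = {poly p x | p. \<forall>i. Polynomial.coeff p i \<in> A}"
    have "is_subring B" "A \<subseteq> B" "x \<in> B"
      using is_subring_adjoin[OF A, of x] by (simp_all add: B_def)
    then have "inverse 2 \<in> B" using max[of B] that by blast
    then obtain p where "inverse 2 = poly p x" "\<forall>i. Polynomial.coeff p i \<in> A"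
      unfolding B_def by blast
    then show ?thesis by metis
  qed
  \<comment> \<open>2 lies in the Jacobson radical of \<open>A\<close>. If
    \<open>u = 1 - 2 * b\<close> had no inverse in \<open>A\<close>, then 1/2 would be a polynomial
    in \<open>inverse u\<close>; multiplying by \<open>u ^ k\<close>, which is 1 modulo 2, puts 1/2
    itself into \<open>A\<close>.\<close>
  have unit: "inverse (1 - 2 * b) \<in> A \<and> 1 - 2 * b \<noteq> 0" if b: "b \<in> A" for b
  proof -
    define u where "u = 1 - 2 * b"
    have u: "u \<in> A" using Ad b is_subring_numeral[OF A] by (auto simp: u_def)
    have u0: "u \<noteq> 0"
    proof
      assume "u = 0"
      then have "b = inverse 2" by (simp add: u_def field_simps)
      then show False using half b by blast
    qed
    have pw: "\<exists>c\<in>A. u ^ k = 1 - 2 * c" for k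
    proof (induction k)
      case 0
      then show ?case using Ad by (intro bexI[of _ 0]) auto
    next
      case (Suc k)
      then obtain c where c: "c \<in> A" "u ^ k = 1 - 2 * c" by auto
      then have "u ^ Suc k = u * (1 - 2 * c)" by simp
      also have "\<dots> = 1 - 2 * (c + b - 2 * (b * c))" by (simp add: u_def algebra_simps)
      finally have "u ^ Suc k = 1 - 2 * (c + b - 2 * (b * c))" .
      moreover have "c + b - 2 * (b * c) \<in> A"
        using c b Ad is_subring_numeral[OF A] by auto
      ultimately show ?case by blast
    qed
    have "inverse u \<in> A"
    proof (rule ccontr)
      assume "inverse u \<notin> A"
      then obtain p where p: "\<forall>i. Polynomial.coeff p i \<in> A" "poly p (inverse u) = inverse 2"
        using half_poly by blast
      define k where "k = Polynomial.degree p"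
      obtain c where c: "c \<in> A" "u ^ k = 1 - 2 * c" using pw by blast
      have "u ^ k * inverse 2 \<in> A"
        using poly_inverse_mult_power_mem[OF A p(1) u u0, of k] p(2) by (simp add: k_def)
      then have "inverse 2 - c \<in> A" using c by (simp add: field_simps)
      then show False using Ad(5)[OF _ c(1), of "inverse 2 - c"] half by simp
    qed
    then show ?thesis using u0 by (simp add: u_def)
  qed
  define good where "good = (\<lambda>x n. \<exists>p. (\<forall>i. Polynomial.coeff p i \<in> A) \<and> poly p x = inverse 2 \<and> Polynomial.degree p = n)"
  have reduce: "\<exists>n' < n. good x n'"
    if x0: "x \<noteq> 0" and n: "good x n" and m: "good (inverse x) m" and mn: "m \<le> n" for x n m
  proof -
    obtain p where p: "\<And>i. Polynomial.coeff p i \<in> A" "poly p x = inverse 2" "Polynomial.degree p = n"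
      using n unfolding good_def by blast
    obtain q where q: "\<And>i. Polynomial.coeff q i \<in> A" "poly q (inverse x) = inverse 2" "Polynomial.degree q = m"
      using m unfolding good_def by blast
    have m0: "m > 0"
    proof (rule ccontr)
      assume "\<not> m > 0"
      then obtain c where "q = [:c:]" using q(3) by (metis degree_eq_zeroE gr0I)
      then have "c \<in> A" "c = inverse 2" using q(1)[of 0] q(2) by auto
      then show False using half by blast
    qed
    define b where "b = Polynomial.coeff q 0"
    define u where "u = 1 - 2 * b"
    have u: "inverse u \<in> A" "u \<noteq> 0" using unit[of b] q(1) by (auto simp: u_def b_def)
    \<comment> \<open>Multiplied by \<open>2 * x ^ m\<close>, the relation for
      \<open>inverse x\<close> expresses \<open>u * x ^ m\<close> by lower powers of
      \<open>x\<close>. As \<open>u\<close> is a unit, the leading term of \<open>p\<close> can be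
      replaced by lower ones.\<close>
    define r where "r = (\<Sum>j=1..m. Polynomial.monom (2 * Polynomial.coeff q j) (m - j))"
    have rA: "Polynomial.coeff r i \<in> A" for i
      unfolding r_def coeff_sum using Ad q(1) is_subring_numeral[OF A]
      by (intro is_subring_sum[OF A]) auto
    have "u = 2 * (\<Sum>j=1..m. Polynomial.coeff q j * inverse x ^ j)"
    proof -
      have "inverse 2 = (\<Sum>j\<le>m. Polynomial.coeff q j * inverse x ^ j)"
        using q(2,3) by (simp add: poly_altdef)
      also have "\<dots> = b + (\<Sum>j=1..m. Polynomial.coeff q j * inverse x ^ j)"
        by (simp add: b_def atMost_atLeast0 sum.atLeast_Suc_atMost)
      finally show ?thesis by (simp add: u_def field_simps)
    qed
    then have "x ^ m * u = (\<Sum>j=1..m. 2 * Polynomial.coeff q j * (x ^ m * inverse x ^ j))"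
      by (simp add: sum_distrib_left mult_ac)
    also have "\<dots> = poly r x" unfolding r_def poly_sum poly_monom
    proof (rule sum.cong)
      fix j assume "j \<in> {1..m}"
      then have "x ^ m = x ^ (m - j) * x ^ j" by (simp flip: power_add)
      then show "2 * Polynomial.coeff q j * (x ^ m * inverse x ^ j) = 2 * Polynomial.coeff q j * x ^ (m - j)"
        using x0 by (simp add: field_simps)
    qed simp
    finally have rx: "poly r x = x ^ m * u" by simp
    have rdeg: "Polynomial.degree r < m" unfolding r_def
      using m0 by (intro degree_sum_less) (auto intro: le_less_trans[OF degree_monom_le])
    define an where "an = Polynomial.coeff p n"
    define p' where "p' = p - Polynomial.monom an n + Polynomial.monom (an * inverse u) (n - m) * r"
    have "Polynomial.coeff p' i \<in> A" for i
    proof -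
      have "Polynomial.coeff (Polynomial.monom (an * inverse u) (n - m) * r) i \<in> A"
        using Ad p(1) u(1) rA by (auto simp: coeff_monom_mult an_def)
      moreover have "Polynomial.coeff (p - Polynomial.monom an n) i \<in> A"
        using Ad p(1) by (auto simp: an_def)
      ultimately show ?thesis unfolding p'_def using Ad by auto
    qed
    moreover have "poly p' x = inverse 2"
    proof -
      have "x ^ n = x ^ (n - m) * x ^ m" using mn by (simp flip: power_add)
      then show ?thesis using p(2) u by (simp add: p'_def poly_monom rx field_simps)
    qed
    moreover have "Polynomial.degree p' < n"
    proof -
      have n0: "n > 0" using m0 mn by simp
      have "Polynomial.degree (p - Polynomial.monom an n) \<le> n"
        using p(3) by (intro degree_diff_le) (auto intro: degree_monom_le)
      moreover have "Polynomial.coeff (p - Polynomial.monom an n) n = 0" by (simp add: an_def)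
      ultimately have "Polynomial.degree (p - Polynomial.monom an n) < n"
        using n0 by (metis le_neq_implies_less leading_coeff_0_iff degree_0)
      moreover have "Polynomial.degree (Polynomial.monom (an * inverse u) (n - m) * r) < n"
      proof -
        have "Polynomial.degree (Polynomial.monom (an * inverse u) (n - m) * r) \<le> (n - m) + Polynomial.degree r"
          by (rule order_trans[OF degree_mult_le]) (auto intro: degree_monom_le)
        then show ?thesis using rdeg mn by linarith
      qed
      ultimately show ?thesis unfolding p'_def by (rule degree_add_less)
    qed
    ultimately show ?thesis unfolding good_def by blast
  qed
  show ?thesis
  proof (rule ccontr)
    assume neg: "\<not> (x \<in> A \<or> inverse x \<in> A)"
    then have x0: "x \<noteq> 0" using Ad by auto
    have ex: "\<exists>n. good x n" "\<exists>n. good (inverse x) n"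
      using neg half_poly[of x] half_poly[of "inverse x"] unfolding good_def by blast+
    define n where "n = (LEAST n. good x n)"
    define m where "m = (LEAST n. good (inverse x) n)"
    have n: "good x n" "\<And>k. k < n \<Longrightarrow> \<not> good x k"
      using ex(1) unfolding n_def by (auto intro: LeastI_ex dest: not_less_Least)
    have m: "good (inverse x) m" "\<And>k. k < m \<Longrightarrow> \<not> good (inverse x) k"
      using ex(2) unfolding m_def by (auto intro: LeastI_ex dest: not_less_Least)
    show False
    proof (cases "m \<le> n")
      case True
      then show False using reduce[OF x0 n(1) m(1)] n(2) by blast
    next
      case False
      then show False using reduce[of "inverse x" m n] x0 n m by auto
    qed
  qed
qed

lemma exists_valuation_ring_two:
  "\<exists>A :: 'b :: field_char_0 set. is_subring A \<and> inverse 2 \<notin> A \<and> (\<forall>x. x \<in> A \<or> inverse x \<in> A)"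
proof -
  define F where "F = {A :: 'b set. is_subring A \<and> inverse 2 \<notin> A}"
  have "range of_int \<in> F"
  proof -
    have "is_subring (range of_int :: 'b set)"
      unfolding is_subring_def
      by (auto intro: range_eqI[of _ _ 1] simp flip: of_int_diff of_int_mult)
    moreover have "inverse 2 \<noteq> (of_int k :: 'b)" for k
    proof
      assume "inverse 2 = (of_int k :: 'b)"
      then have "(1 :: 'b) = of_int (2 * k)" by (simp add: field_simps)
      then have "1 = 2 * k" by (metis of_int_1 of_int_eq_iff)
      then show False by presburger
    qed
    ultimately show ?thesis unfolding F_def by (auto simp: image_iff)
  qed
  moreover have "\<Union>C \<in> F" if C: "C \<noteq> {}" "subset.chain F C" for C
  proof -
    have CF: "\<And>A. A \<in> C \<Longrightarrow> is_subring A \<and> inverse 2 \<notin> A"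
      and lin: "\<And>A B. A \<in> C \<Longrightarrow> B \<in> C \<Longrightarrow> A \<subseteq> B \<or> B \<subseteq> A"
      using C(2) unfolding subset.chain_def F_def by auto
    have "x - y \<in> \<Union>C \<and> x * y \<in> \<Union>C" if xy: "x \<in> \<Union>C" "y \<in> \<Union>C" for x y
    proof -
      obtain A where "A \<in> C" "x \<in> A" "y \<in> A" using xy lin by blast
      then show ?thesis using CF[of A] by (auto simp: is_subring_def)
    qed
    moreover have "1 \<in> \<Union>C" using C(1) CF by (auto simp: is_subring_def)
    ultimately show ?thesis using CF unfolding F_def is_subring_def by blast
  qed
  ultimately obtain A where "A \<in> F" "\<And>B. B \<in> F \<Longrightarrow> A \<subseteq> B \<Longrightarrow> B = A"
    using subset_Zorn_nonempty[of F] by blast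
  then show ?thesis
    using maximal_subring_valuation[of A] unfolding F_def by blast
qed

section \<open>Doubling and three-point collinearity on cubics\<close>

text \<open>\<open>bounded\<close> says that inverting 2 in \<open>V\<close> gives the whole field.
  Hence powers of 2 become small relative to every given element and can serve as parameters tending
  to 0.\<close>

locale dyadic_valuation_ring =
  fixes V :: "'b :: field_char_0 set"
  assumes subring: "is_subring V" and half: "inverse 2 \<notin> V"
    and total: "x \<in> V \<or> inverse x \<in> V" and bounded: "\<exists>n. 2 ^ n * c \<in> V"
begin

lemmas V = is_subringD[OF subring]

text \<open>Membership in the maximal ideal of \<open>V\<close>; 0 is listed apart because
  \<open>inverse 0 = 0\<close> lies in \<open>V\<close>.\<close>

definition small :: "'b \<Rightarrow> bool" where "small x \<longleftrightarrow> x = 0 \<or> inverse x \<notin> V"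

definition unit :: "'b \<Rightarrow> bool" where "unit u \<longleftrightarrow> u \<noteq> 0 \<and> u \<in> V \<and> inverse u \<in> V"

lemma smallD: "small x \<Longrightarrow> x \<in> V"
  using total[of x] V by (auto simp: small_def)

lemma small_mult: "small x \<Longrightarrow> y \<in> V \<Longrightarrow> small (x * y)"
proof (cases "x * y = 0")
  case False
  assume "small x" "y \<in> V"
  have eq: "inverse x = y * inverse (x * y)" using False by (simp add: field_simps)
  have "inverse (x * y) \<notin> V"
  proof
    assume "inverse (x * y) \<in> V"
    then have "inverse x \<in> V" unfolding eq by (rule V(6)[OF \<open>y \<in> V\<close>])
    then show False using \<open>small x\<close> False by (simp add: small_def)
  qed
  then show ?thesis by (simp add: small_def)
qed (simp add: small_def)

lemma small_uminus: "small x \<Longrightarrow> small (- x)"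
  using small_mult[of x "-1"] V by simp

lemma small_add: assumes "small x" "small y" shows "small (x + y)"
proof (cases "x = 0 \<or> y = 0")
  case False
  have "x + y = y * (1 + x / y)" "x + y = x * (1 + inverse (x / y))" using False by (simp_all add: field_simps)
  then show ?thesis using total[of "x / y"] small_mult assms V by metis
qed (use assms in auto)

lemma unit_1_plus_small: assumes "small x" shows "unit (1 + x)"
proof -
  have "\<not> small 1" using V by (simp add: small_def)
  moreover have "1 = (1 + x) + (- x)" by simp
  ultimately have "\<not> small (1 + x)" using small_add small_uminus assms by metis
  then show ?thesis using smallD[OF assms] V by (auto simp: small_def unit_def)
qed

lemma unit_mult: "unit u \<Longrightarrow> unit w \<Longrightarrow> unit (u * w)"
  using V by (auto simp: unit_def)

lemma unit_inverse: "unit u \<Longrightarrow> unit (inverse u)"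
  by (auto simp: unit_def)

lemma small_2: "small 2"
  using half by (auto simp: small_def)

lemma small_power_2: "n > 0 \<Longrightarrow> small (2 ^ n)"
  using small_mult[OF small_2] is_subring_power[OF subring smallD[OF small_2]]
  by (cases n) auto

lemma eventually_small: "\<exists>n. \<forall>k \<ge> n. small (2 ^ k * c)"
proof -
  obtain n where n: "2 ^ n * c \<in> V" using bounded by blast
  have "small (2 ^ k * c)" if "k \<ge> Suc n" for k
  proof -
    have "2 ^ k * c = 2 ^ (k - n) * (2 ^ n * c)"
      using that by (simp flip: power_add mult.assoc)
    moreover have "small (2 ^ (k - n) * (2 ^ n * c))"
      using small_mult[OF small_power_2 n, of "k - n"] that by simp
    ultimately show ?thesis by metis
  qed
  then show ?thesis by blast
qed

text \<open>A common denominator of the coefficients works for all \<open>M\<close>, because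
  \<open>2 ^ M\<close> itself lies in \<open>V\<close>.\<close>

lemma poly_power_2_bounded: "\<exists>n. \<forall>M. 2 ^ n * poly p (2 ^ M) \<in> V"
proof (induction p)
  case 0
  then show ?case using V by auto
next
  case (pCons c p)
  obtain n where n: "\<And>M. 2 ^ n * poly p (2 ^ M) \<in> V" using pCons by blast
  obtain n' where n': "2 ^ n' * c \<in> V" using bounded by blast
  have two: "2 ^ k \<in> V" for k using is_subring_power[OF subring smallD[OF small_2]] .
  have "2 ^ (n + n') * poly (pCons c p) (2 ^ M) \<in> V" for M
  proof -
    have "2 ^ (n + n') * poly (pCons c p) (2 ^ M)
      = 2 ^ n * (2 ^ n' * c) + 2 ^ (n' + M) * (2 ^ n * poly p (2 ^ M))"
      by (simp add: algebra_simps power_add)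
    also have "\<dots> \<in> V" using V(5)[OF V(6)[OF two n'] V(6)[OF two n]] .
    finally show ?thesis .
  qed
  then show ?case by blast
qed

text \<open>Continuity at 0: near 0 a polynomial equals its nonzero constant term up to a factor in
  1 plus the maximal ideal.\<close>

lemma poly_power_2_unit:
  assumes "poly p 0 \<noteq> 0"
  shows "\<exists>M\<^sub>0. \<forall>M \<ge> M\<^sub>0. unit (poly p (2 ^ M) / poly p 0)"
proof -
  obtain c q where p: "p = pCons c q" by (cases p)
  have c: "c \<noteq> 0" "poly p 0 = c" using assms p by auto
  obtain n where n: "\<And>M. 2 ^ n * poly (Polynomial.smult (inverse c) q) (2 ^ M) \<in> V"
    using poly_power_2_bounded by blast
  have "unit (poly p (2 ^ M) / poly p 0)" if "M \<ge> Suc n" for M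
  proof -
    have "(2 :: 'b) ^ M = 2 ^ (M - n) * 2 ^ n" using that by (simp flip: power_add)
    then have "poly p (2 ^ M) / poly p 0 = 1 + 2 ^ (M - n) * (2 ^ n * poly (Polynomial.smult (inverse c) q) (2 ^ M))"
      using c p by (simp add: field_simps)
    then show ?thesis using unit_1_plus_small small_mult[OF small_power_2 n] that by simp
  qed
  then show ?thesis by blast
qed

end

text \<open>
  The \<open>x\<close>-coordinate of a point on \<open>y\<^sup>2 = x (x\<^sup>2 + a x + b)\<close> is represented by an option, with
  \<open>None\<close> for the point at infinity. The map \<open>isog a b\<close> is the 2-isogeny with kernel generated by
  \<open>(0, 0)\<close>; its target has the parameters \<open>- 2 a\<close> and \<open>a\<^sup>2 - 4 b\<close>. Composing it with its dual gives
  parameters \<open>4 a\<close> and \<open>16 b\<close>, hence the rescaling by \<open>1/4\<close> in \<open>dbl\<close>, which is multiplication by 2.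
\<close>

definition isog :: "'b :: field \<Rightarrow> 'b \<Rightarrow> 'b option \<Rightarrow> 'b option" where
  "isog a b p = (case p of None \<Rightarrow> None | Some x \<Rightarrow> if x = 0 then None else Some (x + a + b / x))"

definition dbl :: "'b :: field \<Rightarrow> 'b \<Rightarrow> 'b option \<Rightarrow> 'b option" where
  "dbl a b p = map_option (\<lambda>x. x / 4) (isog (- 2 * a) (a\<^sup>2 - 4 * b) (isog a b p))"

text \<open>
  \<open>sum_rel a b p q s\<close> says that \<open>p\<close>, \<open>q\<close> and \<open>s\<close> are the \<open>x\<close>-coordinates of points with sum zero, for
  suitable choices of signs: comparing \<open>x (x\<^sup>2 + a x + b) - (m x + n)\<^sup>2\<close> with \<open>(x - p) (x - q) (x - s)\<close>
  and eliminating \<open>m\<close> and \<open>n\<close> yields the equation below.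
\<close>

definition sum_rel :: "'b :: field \<Rightarrow> 'b \<Rightarrow> 'b option \<Rightarrow> 'b option \<Rightarrow> 'b \<Rightarrow> bool" where
  "sum_rel a b p q s \<longleftrightarrow> (case p of
     None \<Rightarrow> q = Some s
   | Some x \<Rightarrow> (case q of None \<Rightarrow> x = s
       | Some y \<Rightarrow> (x * y + x * s + y * s - b)\<^sup>2 = 4 * (x + y + s + a) * (x * y * s)))"

text \<open>An isogeny is a homomorphism and so preserves zero sums. On \<open>x\<close>-coordinates
  this is a polynomial identity modulo the relation, once denominators are cleared by
  \<open>x * y * s\<close>.\<close>

lemma sum_rel_isog_aux:
  fixes x y s a b :: "'b :: field_char_0"
  assumes nz: "x \<noteq> 0" "y \<noteq> 0" "s \<noteq> 0"
    and rel: "(x * y + x * s + y * s - b)\<^sup>2 = 4 * (x + y + s + a) * (x * y * s)"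
  defines "x' \<equiv> x + a + b / x" and "y' \<equiv> y + a + b / y" and "s' \<equiv> s + a + b / s"
  shows "(x' * y' + x' * s' + y' * s' - (a\<^sup>2 - 4 * b))\<^sup>2 = 4 * (x' + y' + s' + (- 2 * a)) * (x' * y' * s')"
proof -
  \<comment> \<open>For the line \<open>y = m x + n\<close> through the three points,
    \<open>A\<close>, \<open>c\<close> and \<open>E\<close> are \<open>m^2\<close>,
    \<open>- 2 m n\<close> and \<open>n^2\<close>, so the relation reads \<open>c^2 = 4 A E\<close>.
    Up to shifts they are the elementary symmetric functions of \<open>x\<close>, \<open>y\<close>,
    \<open>s\<close>, so the cleared quantities can be written in them.\<close>
  define E where "E = x * y * s"
  define A where "A = x + y + s + a"
  define c where "c = x * y + x * s + y * s - b"
  define H where "H = E * c + 2 * b * E + b * c * A + 2 * b\<^sup>2 * A + 2 * a * A * E + a * b * c"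
  define N where "N = a * b * c * A + a\<^sup>2 * A * E + b * c\<^sup>2 + a * c * E + b\<^sup>2 * A\<^sup>2 - 2 * b * A * E + E\<^sup>2"
  have E: "E \<noteq> 0" using nz by (simp add: E_def)
  have cancel: "u\<^sup>2 = 4 * v * w" if "(E * u)\<^sup>2 = 4 * (E * v) * (E * w)" for u v w
  proof -
    have "E\<^sup>2 * u\<^sup>2 = E\<^sup>2 * (4 * v * w)" using that by (simp add: power2_eq_square mult_ac)
    then show ?thesis using E by simp
  qed
  have cE: "c\<^sup>2 = 4 * A * E" using rel by (simp add: c_def A_def E_def)
  have xs: "x * x' = x\<^sup>2 + a * x + b" "y * y' = y\<^sup>2 + a * y + b" "s * s' = s\<^sup>2 + a * s + b"
    using nz by (simp_all add: x'_def y'_def s'_def field_simps power2_eq_square)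
  have "E * (x' * y' + x' * s' + y' * s' - (a\<^sup>2 - 4 * b))
     = (x * x') * (y * y') * s + (x * x') * (s * s') * y + (y * y') * (s * s') * x - (a\<^sup>2 - 4 * b) * E"
    by (simp add: E_def algebra_simps)
  also have "\<dots> = H" unfolding xs H_def E_def A_def c_def by Groebner_Basis.algebra
  finally have 1: "E * (x' * y' + x' * s' + y' * s' - (a\<^sup>2 - 4 * b)) = H" .
  have "E * (x' + y' + s' + (- 2 * a)) = (x * x') * y * s + (y * y') * x * s + (s * s') * x * y - 2 * a * E"
    by (simp add: E_def algebra_simps)
  also have "\<dots> = A * E + b * c + b\<^sup>2" unfolding xs E_def A_def c_def by Groebner_Basis.algebra
  finally have 2: "E * (x' + y' + s' + (- 2 * a)) = A * E + b * c + b\<^sup>2" .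
  have "E * (x' * y' * s') = (x * x') * (y * y') * (s * s')"
    by (simp add: E_def algebra_simps)
  also have "\<dots> = N" unfolding xs N_def E_def A_def c_def by Groebner_Basis.algebra
  finally have 3: "E * (x' * y' * s') = N" .
  have "H\<^sup>2 = 4 * (A * E + b * c + b\<^sup>2) * N"
    using cE unfolding H_def N_def by Groebner_Basis.algebra
  then have "(E * (x' * y' + x' * s' + y' * s' - (a\<^sup>2 - 4 * b)))\<^sup>2
      = 4 * (E * (x' + y' + s' + (- 2 * a))) * (E * (x' * y' * s'))"
    unfolding 1 2 3 .
  then show ?thesis by (rule cancel)
qed

lemma sum_rel_isog:
  fixes a b s :: "'b :: field_char_0"
  assumes "b \<noteq> 0" "s \<noteq> 0" "sum_rel a b p q s"
  shows "sum_rel (- 2 * a) (a\<^sup>2 - 4 * b) (isog a b p) (isog a b q) (s + a + b / s)"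
proof -
  \<comment> \<open>\<open>x * s = b\<close> means that the two points differ, up to sign, by the
    kernel point \<open>(0, 0)\<close>, so their images agree. The relation reduces to this when the
    third coordinate is 0.\<close>
  have zero: "x + a + b / x = s + a + b / s \<and> x \<noteq> 0" if "x * s = b" for x
    using that assms by (auto simp: field_simps)
  show ?thesis
  proof (cases p)
    case None
    then show ?thesis using assms by (auto simp: sum_rel_def isog_def)
  next
    case p: (Some x)
    show ?thesis
    proof (cases q)
      case None
      then show ?thesis using assms p by (auto simp: sum_rel_def isog_def)
    next
      case q: (Some y)
      have rel: "(x * y + x * s + y * s - b)\<^sup>2 = 4 * (x + y + s + a) * (x * y * s)"
        using assms(3) p q by (simp add: sum_rel_def)
      consider "x = 0" | "x \<noteq> 0" "y = 0" | "x \<noteq> 0" "y \<noteq> 0" by blast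
      then show ?thesis
      proof cases
        case 1
        then have "y * s = b" using rel by simp
        then show ?thesis using zero[of y] p q 1 by (simp add: sum_rel_def isog_def)
      next
        case 2
        then have "x * s = b" using rel by simp
        then show ?thesis using zero[of x] p q 2 by (simp add: sum_rel_def isog_def)
      next
        case 3
        then show ?thesis
          using sum_rel_isog_aux[OF 3 assms(2) rel] p q by (simp add: sum_rel_def isog_def)
      qed
    qed
  qed
qed

text \<open>The isomorphism \<open>(x, y) -> (x / 4, y / 8)\<close> between the two curves.\<close>

lemma sum_rel_scale:
  fixes a b s :: "'b :: field_char_0"
  assumes "sum_rel (4 * a) (16 * b) p q s"
  shows "sum_rel a b (map_option (\<lambda>x. x / 4) p) (map_option (\<lambda>x. x / 4) q) (s / 4)"
proof -
  have "(x / 4 * (y / 4) + x / 4 * (s / 4) + y / 4 * (s / 4) - b)\<^sup>2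
      = 4 * (x / 4 + y / 4 + s / 4 + a) * (x / 4 * (y / 4) * (s / 4))"
    if "(x * y + x * s + y * s - 16 * b)\<^sup>2 = 4 * (x + y + s + 4 * a) * (x * y * s)" for x y
  proof -
    have "(x / 4 * (y / 4) + x / 4 * (s / 4) + y / 4 * (s / 4) - b)\<^sup>2
      = (x * y + x * s + y * s - 16 * b)\<^sup>2 / 256" by (simp add: field_simps power2_eq_square)
    also have "\<dots> = 4 * (x / 4 + y / 4 + s / 4 + a) * (x / 4 * (y / 4) * (s / 4))"
      unfolding that by (simp add: field_simps)
    finally show ?thesis .
  qed
  note * = this
  show ?thesis
  proof (cases "\<exists>x y. p = Some x \<and> q = Some y")
    case True
    then obtain x y where pq: "p = Some x" "q = Some y" by blast
    show ?thesis using *[of x y] assms unfolding pq sum_rel_def option.case option.map .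
  next
    case False
    then show ?thesis using assms by (auto simp: sum_rel_def split: option.splits)
  qed
qed

lemma finite_sum_rel:
  fixes a b :: "'b :: field_char_0"
  assumes "b \<noteq> 0" "a\<^sup>2 \<noteq> 4 * b"
  shows "finite {s. sum_rel a b p q s}"
proof (cases "\<exists>x y. p = Some x \<and> q = Some y")
  case False
  then have "{s. sum_rel a b p q s} \<subseteq> {the p, the q}"
    by (auto simp: sum_rel_def split: option.splits)
  then show ?thesis by (rule finite_subset) simp
next
  case True
  then obtain x y where p: "p = Some x" and q: "q = Some y" by blast
  \<comment> \<open>The relation as a quadratic polynomial in \<open>s\<close>, whose roots belong
    to the sum and the difference of the two points. It vanishes identically only for
    \<open>x = y\<close>, \<open>x^2 = b\<close>, \<open>a = - 2 x\<close>, which would make the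
    curve singular.\<close>
  define r where "r = [:(x * y - b)\<^sup>2, - 2 * ((x + y) * (x * y + b) + 2 * a * (x * y)), (x - y)\<^sup>2:]"
  have "r \<noteq> 0"
  proof
    assume "r = 0"
    then have xy: "x = y" "x * y = b" "(x + y) * (x * y + b) + 2 * a * (x * y) = 0"
      unfolding r_def by (auto simp: pCons_eq_0_iff simp del: mult_minus_left)
    then have "b * (2 * (2 * x + a)) = 0" by (simp add: algebra_simps)
    then have "2 * (2 * x + a) = 0" using assms by (metis mult_eq_0_iff)
    then have "2 * x + a = 0" by (metis mult_eq_0_iff zero_neq_numeral)
    then have "a = - 2 * x" by (simp add: eq_neg_iff_add_eq_0 add.commute)
    then have "a\<^sup>2 = 4 * b" using xy by (simp add: power2_eq_square)
    then show False using assms by simp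
  qed
  moreover have "{s. sum_rel a b p q s} \<subseteq> {s. poly r s = 0}"
  proof
    fix s assume "s \<in> {s. sum_rel a b p q s}"
    then have "(x * y + x * s + y * s - b)\<^sup>2 = 4 * (x + y + s + a) * (x * y * s)"
      by (simp add: sum_rel_def p q)
    then have "poly r s = 0" unfolding r_def poly_pCons poly_0 by Groebner_Basis.algebra
    then show "s \<in> {s. poly r s = 0}" by simp
  qed
  ultimately show ?thesis using poly_roots_finite finite_subset by blast
qed

section \<open>Growth of \<open>x\<close>-coordinates near the origin under doubling\<close>

context dyadic_valuation_ring
begin

text \<open>A neighbourhood of the point at infinity, in which \<open>s\<close> dominates both
  \<open>a\<close> and \<open>b / s\<close>.\<close>

definition large :: "'b \<Rightarrow> 'b \<Rightarrow> 'b \<Rightarrow> bool" where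
  "large a b s \<longleftrightarrow> s \<noteq> 0 \<and> small (a / s) \<and> small (b / s\<^sup>2)"

text \<open>The dominant term gives \<open>s' = s * u\<close> with \<open>u\<close> in 1 plus the
  maximal ideal, so an isogeny keeps the size of \<open>s\<close>. The conditions for the new
  parameters follow because these are integral combinations of the old ones.\<close>

lemma large_isog:
  assumes "large a b s"
  defines "s' \<equiv> s + a + b / s"
  shows "large (- 2 * a) (a\<^sup>2 - 4 * b) s'" "unit (s' / s)"
proof -
  have s: "s \<noteq> 0" "small (a / s)" "small (b / s\<^sup>2)" using assms by (auto simp: large_def)
  define u where "u = 1 + (a / s + b / s\<^sup>2)"
  have u: "unit u" unfolding u_def using s by (intro unit_1_plus_small small_add)
  have s': "s' = s * u" using s by (simp add: s'_def u_def field_simps power2_eq_square)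
  then show "unit (s' / s)" using u s by simp
  have u': "u \<noteq> 0" "inverse u \<in> V" using u by (auto simp: unit_def)
  note two = smallD[OF small_2]
  have "small (- 2 * a / s')"
  proof -
    have "- 2 * a / s' = (a / s) * (- 2 * inverse u)" using s u' by (simp add: s' field_simps)
    moreover have "- 2 * inverse u \<in> V" using V(3,6) two u' by simp
    ultimately show ?thesis using small_mult[OF s(2)] by metis
  qed
  moreover have "small ((a\<^sup>2 - 4 * b) / s'\<^sup>2)"
  proof -
    have "(a\<^sup>2 - 4 * b) / s'\<^sup>2 = ((a / s) * (a / s) + (b / s\<^sup>2) * (- (2 * 2))) * (inverse u * inverse u)"
      using s u' by (simp add: s' field_simps power2_eq_square)
    moreover have "small ((a / s) * (a / s))" using small_mult[OF s(2) smallD[OF s(2)]] .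
    moreover have "small ((b / s\<^sup>2) * (- (2 * 2)))" by (intro small_mult[OF s(3)] V(3) V(6)[OF two two])
    ultimately show ?thesis using small_mult[OF small_add V(6)[OF u'(2) u'(2)]] by metis
  qed
  moreover have "s' \<noteq> 0" using s s' u' by simp
  ultimately show "large (- 2 * a) (a\<^sup>2 - 4 * b) s'" by (simp add: large_def)
qed

lemma large_dbl:
  assumes "large a b s"
  shows "\<exists>s'. dbl a b (Some s) = Some s' \<and> large a b s' \<and> unit (4 * s' / s)"
proof -
  define s1 where "s1 = s + a + b / s"
  define s2 where "s2 = s1 + (- 2 * a) + (a\<^sup>2 - 4 * b) / s1"
  have 1: "large (- 2 * a) (a\<^sup>2 - 4 * b) s1" "unit (s1 / s)"
    using large_isog[OF assms] by (simp_all add: s1_def)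
  have 2: "large (- 2 * (- 2 * a)) ((- 2 * a)\<^sup>2 - 4 * (a\<^sup>2 - 4 * b)) s2" "unit (s2 / s1)"
    using large_isog[OF 1(1)] by (simp_all add: s2_def)
  have s: "s \<noteq> 0" "s1 \<noteq> 0" using assms 1 by (auto simp: large_def)
  have "dbl a b (Some s) = Some (s2 / 4)"
    using s by (simp add: dbl_def isog_def s1_def s2_def)
  moreover have "large a b (s2 / 4)"
    using 2(1) by (simp add: large_def power2_eq_square algebra_simps)
  moreover have "4 * (s2 / 4) / s = (s2 / s1) * (s1 / s)" using s by simp
  ultimately show ?thesis using unit_mult[OF 2(2) 1(2)] by metis
qed

lemma sum_rel_dbl:
  assumes "b \<noteq> 0" "a\<^sup>2 \<noteq> 4 * b" "large a b s" "sum_rel a b p q s" "dbl a b (Some s) = Some s'"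
  shows "sum_rel a b (dbl a b p) (dbl a b q) s'"
proof -
  define s1 where "s1 = s + a + b / s"
  define s2 where "s2 = s1 + (- 2 * a) + (a\<^sup>2 - 4 * b) / s1"
  have 1: "large (- 2 * a) (a\<^sup>2 - 4 * b) s1"
    using large_isog[OF assms(3)] by (simp_all add: s1_def)
  have s: "s \<noteq> 0" "s1 \<noteq> 0" using assms 1 by (auto simp: large_def)
  have s': "s' = s2 / 4" using assms(5) s by (simp add: dbl_def isog_def s1_def s2_def)
  have "sum_rel (- 2 * a) (a\<^sup>2 - 4 * b) (isog a b p) (isog a b q) s1"
    unfolding s1_def using assms s by (intro sum_rel_isog) auto
  from sum_rel_isog[OF _ _ this] assms(2) s
  have "sum_rel (- 2 * (- 2 * a)) ((- 2 * a)\<^sup>2 - 4 * (a\<^sup>2 - 4 * b))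
    (isog (- 2 * a) (a\<^sup>2 - 4 * b) (isog a b p)) (isog (- 2 * a) (a\<^sup>2 - 4 * b) (isog a b q)) s2"
    by (simp add: s2_def)
  moreover have "- 2 * (- 2 * a) = 4 * a" "(- 2 * a)\<^sup>2 - 4 * (a\<^sup>2 - 4 * b) = 16 * b"
    by (simp_all add: power2_eq_square algebra_simps)
  ultimately show ?thesis unfolding s' dbl_def using sum_rel_scale by metis
qed

text \<open>If both orbits were finite, the doubles \<open>t k\<close> of \<open>s\<close> would lie
  in a finite union of finite sets. But \<open>4 ^ j * t (k + j) / t k\<close> is a unit and a
  positive power of 4 is not, so the \<open>t k\<close> are distinct.\<close>

theorem infinite_orbit_of_sum_rel:
  assumes "b \<noteq> 0" "a\<^sup>2 \<noteq> 4 * b" "large a b s" "sum_rel a b p q s"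
  shows "infinite (range (\<lambda>k. (dbl a b ^^ k) p)) \<or> infinite (range (\<lambda>k. (dbl a b ^^ k) q))"
proof (rule ccontr)
  assume "\<not> ?thesis"
  then have fin: "finite (range (\<lambda>k. (dbl a b ^^ k) p))" "finite (range (\<lambda>k. (dbl a b ^^ k) q))" by auto
  \<comment> \<open>Doubling a \<open>large\<close> value never yields \<open>None\<close>, so
    \<open>the\<close> always meets a genuine value.\<close>
  define t where "t = rec_nat s (\<lambda>_ s. the (dbl a b (Some s)))"
  have inv: "large a b (t k) \<and> sum_rel a b ((dbl a b ^^ k) p) ((dbl a b ^^ k) q) (t k)" for k
  proof (induction k)
    case 0
    then show ?case using assms by (simp add: t_def)
  next
    case (Suc k)
    then obtain s' where s': "dbl a b (Some (t k)) = Some s'" "large a b s'" using large_dbl by blast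
    then have "t (Suc k) = s'" by (simp add: t_def)
    then show ?case using sum_rel_dbl[OF assms(1,2) _ _ s'(1)] Suc s'(2) by simp
  qed
  have step: "unit (4 * t (Suc k) / t k)" for k
    using large_dbl[of a b "t k"] inv[of k] by (auto simp: t_def)
  have nz: "t k \<noteq> 0" for k using inv by (auto simp: large_def)
  have ratio: "unit (4 ^ j * t (k + j) / t k)" for k j
  proof (induction j)
    case 0
    then show ?case using nz V by (simp add: unit_def)
  next
    case (Suc j)
    have "4 ^ Suc j * t (k + Suc j) / t k = (4 * t (Suc (k + j)) / t (k + j)) * (4 ^ j * t (k + j) / t k)"
      using nz by (simp add: field_simps)
    then show ?case using unit_mult[OF step[of "k + j"] Suc] by metis
  qed
  have "inj t"
  proof (rule linorder_injI)
    fix i k :: nat assume "i < k"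
    show "t i \<noteq> t k"
    proof
      assume eq: "t i = t k"
      have "unit (4 ^ (k - i))" using ratio[of "k - i" i] \<open>i < k\<close> nz[of i] eq by simp
      moreover have "(4 :: 'b) ^ (k - i) = 2 ^ (2 * (k - i))" by (simp add: power_mult)
      moreover have "small (2 ^ (2 * (k - i)))" using \<open>i < k\<close> by (intro small_power_2) simp
      ultimately show False by (auto simp: unit_def small_def)
    qed
  qed
  moreover have "range t \<subseteq> (\<Union>x \<in> range (\<lambda>k. (dbl a b ^^ k) p). \<Union>y \<in> range (\<lambda>k. (dbl a b ^^ k) q). {s. sum_rel a b x y s})"
    using inv by blast
  moreover have "finite \<dots>" using fin finite_sum_rel[OF assms(1,2)] by blast
  ultimately show False using finite_subset finite_imageD by blast
qed

end

section \<open>Two nearby parameters whose difference is close to the origin\<close>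

lemma exists_sum_rel:
  fixes a b x y :: "'b :: {alg_closed_field, field_char_0}"
  assumes "x \<noteq> y"
  shows "\<exists>s s'. sum_rel a b (Some x) (Some y) s \<and> sum_rel a b (Some x) (Some y) s' \<and>
    s + s' = 2 * ((x + y) * (x * y + b) + 2 * a * (x * y)) / (x - y)\<^sup>2"
proof -
  define B where "B = (x + y) * (x * y + b) + 2 * a * (x * y)"
  define r where "r = [:(x * y - b)\<^sup>2, - 2 * B, (x - y)\<^sup>2:]"
  have rel: "sum_rel a b (Some x) (Some y) s \<longleftrightarrow> poly r s = 0" for s
  proof -
    have "(x * y + x * s + y * s - b)\<^sup>2 - 4 * (x + y + s + a) * (x * y * s) = poly r s"
      unfolding r_def B_def poly_pCons poly_0 by Groebner_Basis.algebra
    then show ?thesis by (auto simp: sum_rel_def)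
  qed
  have "Polynomial.degree r > 0" using assms by (simp add: r_def)
  then obtain s where s: "poly r s = 0" using alg_closed_imp_poly_has_root by blast
  \<comment> \<open>The second root by Vieta. A single root would need a square root, whereas
    \<open>s + s'\<close> is rational in the data and can be estimated; a large sum forces a large
    summand.\<close>
  define s' where "s' = 2 * B / (x - y)\<^sup>2 - s"
  have "(x - y)\<^sup>2 * (s + s') = 2 * B" using assms by (simp add: s'_def)
  moreover have "poly r s' - poly r s = (s' - s) * ((x - y)\<^sup>2 * (s + s') - 2 * B)"
    unfolding r_def poly_pCons poly_0 by Groebner_Basis.algebra
  ultimately have "poly r s' = 0" using s by simp
  then show ?thesis using s rel by (intro exI[of _ s] exI[of _ s']) (simp add: s'_def B_def)
qed

lemma (in dyadic_valuation_ring) eventually_large: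
  "\<exists>N. \<forall>s. 2 ^ N * s \<notin> V \<longrightarrow> large a b s"
proof -
  obtain n1 where n1: "\<forall>k\<ge>n1. small (2 ^ k * a)" using eventually_small by blast
  obtain n2 where n2: "\<forall>k\<ge>n2. small (2 ^ k * b)" using eventually_small by blast
  define N where "N = max n1 n2"
  have N: "small (2 ^ N * a)" "small (2 ^ N * b)" using n1 n2 by (simp_all add: N_def)
  have "large a b s" if s: "2 ^ N * s \<notin> V" for s
  proof -
    have s0: "s \<noteq> 0" using s V by auto
    have i: "inverse (2 ^ N * s) \<in> V" using s total[of "2 ^ N * s"] by simp
    have "a / s = (2 ^ N * a) * inverse (2 ^ N * s)" using s0 by (simp add: field_simps)
    then have "small (a / s)" using small_mult[OF N(1) i] by metis
    moreover have "b / s\<^sup>2 = (2 ^ N * b) * (2 ^ N * (inverse (2 ^ N * s) * inverse (2 ^ N * s)))"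
      using s0 by (simp add: field_simps power2_eq_square)
    then have "small (b / s\<^sup>2)"
      using small_mult[OF N(2) V(6)[OF is_subring_power[OF subring smallD[OF small_2]] V(6)[OF i i]]] by metis
    ultimately show ?thesis using s0 by (simp add: large_def)
  qed
  then show ?thesis by blast
qed

text \<open>
  With \<open>a\<close>, \<open>d1\<close>, \<open>d2\<close> as in the next theorem, this says that \<open>w\<^sup>2 / (4 p1 p2)\<close>, the
  \<open>x\<close>-coordinate attached to the parameter \<open>t\<close>, is the image of \<open>d2 p1 / p2\<close> under the dual isogeny.
\<close>

lemma wronskian_square:
  fixes l0 l1 l2 n0 n1 n2 t :: "'b :: field_char_0"
  shows "((l0 + l1 * t + l2 * t\<^sup>2) * (n1 + 2 * n2 * t) - (l1 + 2 * l2 * t) * (n0 + n1 * t + n2 * t\<^sup>2))\<^sup>2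
    = (n1\<^sup>2 - 4 * n0 * n2) * (l0 + l1 * t + l2 * t\<^sup>2)\<^sup>2
      - 2 * (l1 * n1 - 2 * (l0 * n2 + l2 * n0)) * (l0 + l1 * t + l2 * t\<^sup>2) * (n0 + n1 * t + n2 * t\<^sup>2)
      + (l1\<^sup>2 - 4 * l0 * l2) * (n0 + n1 * t + n2 * t\<^sup>2)\<^sup>2"
  by Groebner_Basis.algebra

text \<open>\<open>b\<close> is the resultant of the two quadratics and \<open>a^2 - 4 b\<close> the
  product of their discriminants, so \<open>nz\<close> says that the quartic form has no multiple
  root. The candidates compared are \<open>k\<close> and \<open>k + 2 ^ M\<close> for large
  \<open>M\<close>.\<close>

theorem exists_infinite_orbit:
  fixes l0 l1 l2 n0 n1 n2 :: "'b :: {alg_closed_field, field_char_0}"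
  assumes "dyadic_valuation_ring (V :: 'b set)"
  defines "p1 \<equiv> \<lambda>t. l0 + l1 * t + l2 * t\<^sup>2" and "p2 \<equiv> \<lambda>t. n0 + n1 * t + n2 * t\<^sup>2"
    and "w \<equiv> \<lambda>t. (l0 + l1 * t + l2 * t\<^sup>2) * (n1 + 2 * n2 * t) - (l1 + 2 * l2 * t) * (n0 + n1 * t + n2 * t\<^sup>2)"
    and "a \<equiv> l1 * n1 - 2 * (l0 * n2 + l2 * n0)"
    and "b \<equiv> (l0 * n2 - l2 * n0)\<^sup>2 - (l0 * n1 - l1 * n0) * (l1 * n2 - l2 * n1)"
  assumes nz: "b \<noteq> 0" "a\<^sup>2 \<noteq> 4 * b"
  shows "\<exists>k :: nat. p1 (of_nat k) \<noteq> 0 \<and> p2 (of_nat k) \<noteq> 0 \<and>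
    infinite (range (\<lambda>j. (dbl a b ^^ j) (Some ((w (of_nat k))\<^sup>2 / (4 * (p1 (of_nat k) * p2 (of_nat k)))))))"
proof -
  interpret dyadic_valuation_ring V by fact
  define d1 where "d1 = l1\<^sup>2 - 4 * l0 * l2"
  define d2 where "d2 = n1\<^sup>2 - 4 * n0 * n2"
  have disc: "d1 * d2 = a\<^sup>2 - 4 * b" unfolding d1_def d2_def a_def b_def by Groebner_Basis.algebra
  then have d0: "d1 \<noteq> 0" "d2 \<noteq> 0" using nz by auto
  have w_sq: "(w t)\<^sup>2 = d2 * (p1 t)\<^sup>2 - 2 * a * p1 t * p2 t + d1 * (p2 t)\<^sup>2" for t
    unfolding w_def d1_def d2_def a_def p1_def p2_def by (rule wronskian_square)
  define P1 where "P1 = [:l0, l1, l2:]"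
  define P2 where "P2 = [:n0, n1, n2:]"
  define W where "W = [:l0 * n1 - l1 * n0, 2 * (l0 * n2 - l2 * n0), l1 * n2 - l2 * n1:]"
  have P: "poly P1 t = p1 t" "poly P2 t = p2 t" "poly W t = w t" for t
    by (simp_all add: P1_def P2_def W_def p1_def p2_def w_def algebra_simps power2_eq_square)
  \<comment> \<open>The discriminants of \<open>P1\<close>, \<open>P2\<close> and \<open>W\<close>
    are \<open>d1\<close>, \<open>d2\<close> and \<open>4 * b\<close>, all nonzero.\<close>
  have "P1 * P2 * W \<noteq> 0"
    using d0 nz by (auto simp: P1_def P2_def W_def d1_def d2_def b_def)
  then have "finite {t. poly (P1 * P2 * W) t = 0}" by (rule poly_roots_finite)
  then have "finite (of_nat -` {t. poly (P1 * P2 * W) t = 0} :: nat set)"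
    by (rule finite_vimageI) (simp add: inj_of_nat)
  then obtain k where k: "poly (P1 * P2 * W) (of_nat k) \<noteq> 0"
    using ex_new_if_finite[OF infinite_UNIV_nat] by blast
  define t1 where "t1 = (of_nat k :: 'b)"
  define p where "p = p1 t1"
  define q where "q = p2 t1"
  have pq: "p \<noteq> 0" "q \<noteq> 0" "w t1 \<noteq> 0" using k by (auto simp: p_def q_def t1_def P)
  define S1 where "S1 = pcompose P1 [:t1, 1:]"
  define S2 where "S2 = pcompose P2 [:t1, 1:]"
  \<comment> \<open>The difference quotient of the ratio of the quadratics, without denominators:
    \<open>p * p2 (t1 + x) - q * p1 (t1 + x)\<close> is \<open>x\<close> times its value at
    \<open>x\<close>. At 0 it is the Wronskian.\<close>
  define \<kappa> where "\<kappa> = [:w t1, p * n2 - l2 * q:]"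
  \<comment> \<open>Up to explicit factors, the numerator of \<open>s + s'\<close> for the
    parameters \<open>t1\<close> and \<open>t1 + x\<close>. Its value at 0 is
    \<open>2 * p * q * (w t1)^2\<close>, so \<open>s + s'\<close> behaves like
    \<open>4 * p * q / x^2\<close>.\<close>
  define \<beta> where "\<beta> = (Polynomial.smult p S2 + Polynomial.smult q S1) *
      (Polynomial.smult (d2 * p) S1 + Polynomial.smult (d1 * q) S2) - Polynomial.smult (4 * a * p * q) (S1 * S2)"
  have S: "poly S1 x = p1 (t1 + x)" "poly S2 x = p2 (t1 + x)" for x
    by (simp_all add: S1_def S2_def poly_pcompose P)
  have \<beta>: "poly \<beta> x = (p * p2 (t1 + x) + q * p1 (t1 + x)) * (d2 * p * p1 (t1 + x) + d1 * q * p2 (t1 + x))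
      - 4 * a * p * q * (p1 (t1 + x) * p2 (t1 + x))" for x
    by (simp add: \<beta>_def S)
  have "poly \<beta> 0 = 2 * p * q * (d2 * p\<^sup>2 - 2 * a * p * q + d1 * q\<^sup>2)"
    unfolding \<beta> by (simp add: p_def[symmetric] q_def[symmetric] algebra_simps power2_eq_square)
  then have \<beta>0: "poly \<beta> 0 = 2 * p * q * (w t1)\<^sup>2" unfolding w_sq p_def q_def .
  have nz0: "poly S1 0 \<noteq> 0" "poly S2 0 \<noteq> 0" "poly \<kappa> 0 \<noteq> 0" "poly \<beta> 0 \<noteq> 0"
    using pq unfolding \<beta>0 by (simp_all add: S p_def q_def \<kappa>_def)
  obtain m1 where m1: "\<forall>M\<ge>m1. unit (poly S1 (2 ^ M) / poly S1 0)" using poly_power_2_unit nz0 by blast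
  obtain m2 where m2: "\<forall>M\<ge>m2. unit (poly S2 (2 ^ M) / poly S2 0)" using poly_power_2_unit nz0 by blast
  obtain m3 where m3: "\<forall>M\<ge>m3. unit (poly \<kappa> (2 ^ M) / poly \<kappa> 0)" using poly_power_2_unit nz0 by blast
  obtain m4 where m4: "\<forall>M\<ge>m4. unit (poly \<beta> (2 ^ M) / poly \<beta> 0)" using poly_power_2_unit nz0 by blast
  obtain N where N: "\<And>s. 2 ^ N * s \<notin> V \<Longrightarrow> large (- 2 * a) (d1 * d2) s" using eventually_large by blast
  \<comment> \<open>The inverse factor absorbs the constant \<open>4 * p * q\<close> and the
    threshold \<open>2 ^ N\<close> for \<open>large\<close>; the bound is applied with
    \<open>m = 2 * M\<close>, where \<open>2 ^ m\<close> is the square of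
    \<open>\<tau>\<close>.\<close>
  obtain m5 where m5: "\<forall>m\<ge>m5. small (2 ^ m * inverse (2 ^ Suc N * (4 * p * q)))" using eventually_small by blast
  define M where "M = Max {m1, m2, m3, m4, m5}"
  have M: "m1 \<le> M" "m2 \<le> M" "m3 \<le> M" "m4 \<le> M" "m5 \<le> M" unfolding M_def by (auto intro: Max_ge)
  \<comment> \<open>A power of 2 is small in \<open>V\<close> and at the same time a natural number,
    so \<open>t2\<close> is again a natural number.\<close>
  define \<tau> where "\<tau> = (2 ^ M :: 'b)"
  have \<tau>0: "\<tau> \<noteq> 0" by (simp add: \<tau>_def)
  define t2 where "t2 = t1 + \<tau>"
  define p' where "p' = p1 t2"
  define q' where "q' = p2 t2"
  define c where "c = poly \<kappa> \<tau>"
  define B where "B = poly \<beta> \<tau>"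
  have p'q': "p' \<noteq> 0" "q' \<noteq> 0" using m1 m2 M by (auto simp: p'_def q'_def t2_def \<tau>_def S unit_def)
  have uc: "unit (c / w t1)" using m3 M by (auto simp: c_def \<tau>_def \<kappa>_def)
  have uB: "unit (B / (2 * p * q * (w t1)\<^sup>2))" using m4 M by (auto simp: B_def \<tau>_def \<beta>0)
  have c0: "c \<noteq> 0" using uc by (auto simp: unit_def)
  have pc: "p * q' - p' * q = \<tau> * c"
    unfolding p_def q_def p'_def q'_def c_def \<kappa>_def t2_def p1_def p2_def w_def poly_pCons poly_0
    by Groebner_Basis.algebra
  have B: "B = (p * q' + q * p') * (d2 * p * p' + d1 * q * q') - 4 * a * p * q * (p' * q')"
    unfolding B_def \<beta> p'_def q'_def t2_def ..
  define z1 where "z1 = d2 * p / q"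
  define z2 where "z2 = d2 * p' / q'"
  have z0: "z1 \<noteq> 0" "z2 \<noteq> 0" using pq p'q' d0 by (simp_all add: z1_def z2_def)
  have zd: "z1 - z2 = d2 * (\<tau> * c) / (q * q')"
    using pq p'q' by (simp add: z1_def z2_def pc[symmetric] field_simps)
  then have "z1 \<noteq> z2" using d0 \<tau>0 c0 pq p'q' by auto
  then obtain s s' where ss: "sum_rel (- 2 * a) (d1 * d2) (Some z1) (Some z2) s"
      "sum_rel (- 2 * a) (d1 * d2) (Some z1) (Some z2) s'"
      "s + s' = 2 * ((z1 + z2) * (z1 * z2 + d1 * d2) + 2 * (- 2 * a) * (z1 * z2)) / (z1 - z2)\<^sup>2"
    using exists_sum_rel[of z1 z2 "- 2 * a" "d1 * d2"] by blast
  have "(z1 + z2) * (z1 * z2 + d1 * d2) + 2 * (- 2 * a) * (z1 * z2) = d2\<^sup>2 * B / (q * q')\<^sup>2"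
    unfolding B using pq p'q' by (simp add: z1_def z2_def field_simps power2_eq_square)
  then have sum: "s + s' = 2 * B / (\<tau> * c)\<^sup>2"
    unfolding ss(3) zd using d0 pq p'q' \<tau>0 c0 by (simp add: power_divide power_mult_distrib)
  have "2 ^ N * (s + s') \<notin> V"
  proof
    assume in_V: "2 ^ N * (s + s') \<in> V"
    define u where "u = (B / (2 * p * q * (w t1)\<^sup>2)) * (inverse (c / w t1) * inverse (c / w t1))"
    have u: "unit u" unfolding u_def using uB uc unit_mult unit_inverse by metis
    have ssu: "s + s' = 4 * p * q * u / \<tau>\<^sup>2"
      unfolding sum u_def using pq c0 \<tau>0 by (simp add: field_simps power2_eq_square)
    have "2 ^ (2 * M) = \<tau>\<^sup>2" by (simp add: \<tau>_def mult.commute flip: power_mult)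
    then have "1 = (2 ^ (2 * M) * inverse (2 ^ Suc N * (4 * p * q))) * (2 * (2 ^ N * (s + s')) * inverse u)"
      unfolding ssu using pq u \<tau>0 by (simp add: unit_def field_simps)
    moreover have "2 * (2 ^ N * (s + s')) * inverse u \<in> V"
      using in_V u V(6) smallD[OF small_2] by (simp add: unit_def)
    moreover have "small (2 ^ (2 * M) * inverse (2 ^ Suc N * (4 * p * q)))" using m5 M by simp
    ultimately have "small 1" using small_mult by metis
    then show False using V by (simp add: small_def)
  qed
  then have "2 ^ N * s \<notin> V \<or> 2 ^ N * s' \<notin> V" using V(5) by (auto simp: distrib_left)
  then obtain r where r: "sum_rel (- 2 * a) (d1 * d2) (Some z1) (Some z2) r" "large (- 2 * a) (d1 * d2) r"
    using ss N by blast
  define R where "R = r + (- 2 * a) + d1 * d2 / r"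
  have dd: "- 2 * (- 2 * a) = 4 * a" "(- 2 * a)\<^sup>2 - 4 * (d1 * d2) = 16 * b"
    unfolding disc by (simp_all add: power2_eq_square algebra_simps)
  have "large (4 * a) (16 * b) R" using large_isog(1)[OF r(2)] unfolding R_def dd .
  then have "large a b (R / 4)" by (simp add: large_def power2_eq_square algebra_simps)
  moreover have "r \<noteq> 0" using r by (simp add: large_def)
  then have "sum_rel (4 * a) (16 * b) (isog (- 2 * a) (d1 * d2) (Some z1)) (isog (- 2 * a) (d1 * d2) (Some z2)) R"
    using sum_rel_isog[OF _ _ r(1)] d0 unfolding R_def dd by simp
  then have "sum_rel a b (map_option (\<lambda>x. x / 4) (isog (- 2 * a) (d1 * d2) (Some z1)))
      (map_option (\<lambda>x. x / 4) (isog (- 2 * a) (d1 * d2) (Some z2))) (R / 4)" by (rule sum_rel_scale)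
  moreover have iso: "map_option (\<lambda>x. x / 4) (isog (- 2 * a) (d1 * d2) (Some (d2 * p1 t / p2 t)))
      = Some ((w t)\<^sup>2 / (4 * (p1 t * p2 t)))" if "p1 t \<noteq> 0" "p2 t \<noteq> 0" for t
  proof -
    have "d2 * p1 t / p2 t + (- 2 * a) + d1 * d2 / (d2 * p1 t / p2 t) = (w t)\<^sup>2 / (p1 t * p2 t)"
      unfolding w_sq using that d0 by (simp add: field_simps power2_eq_square)
    then show ?thesis using that d0 by (simp add: isog_def)
  qed
  ultimately have "sum_rel a b (Some ((w t1)\<^sup>2 / (4 * (p1 t1 * p2 t1)))) (Some ((w t2)\<^sup>2 / (4 * (p1 t2 * p2 t2)))) (R / 4)"
    "large a b (R / 4)"
    using iso[of t1] iso[of t2] pq p'q' unfolding z1_def z2_def p_def q_def p'_def q'_def by metis+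
  from infinite_orbit_of_sum_rel[OF nz this(2,1)] show ?thesis
  proof
    assume "infinite (range (\<lambda>j. (dbl a b ^^ j) (Some ((w t1)\<^sup>2 / (4 * (p1 t1 * p2 t1))))))"
    then show ?thesis using pq unfolding p_def q_def t1_def by (intro exI[of _ k]) simp
  next
    assume "infinite (range (\<lambda>j. (dbl a b ^^ j) (Some ((w t2)\<^sup>2 / (4 * (p1 t2 * p2 t2))))))"
    moreover have "t2 = of_nat (k + 2 ^ M)" by (simp add: t2_def t1_def \<tau>_def)
    ultimately show ?thesis using p'q' unfolding p'_def q'_def by (intro exI[of _ "k + 2 ^ M"]) simp
  qed
qed

section \<open>Points on quartics over quadratic extensions\<close>

definition is_subfield :: "'b :: field set \<Rightarrow> bool" where
  "is_subfield L \<longleftrightarrow> is_subring L \<and> (\<forall>x\<in>L. inverse x \<in> L)"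

lemma is_subfieldD:
  assumes "is_subfield L"
  shows "1 \<in> L" "0 \<in> L" "x \<in> L \<Longrightarrow> - x \<in> L" "x \<in> L \<Longrightarrow> y \<in> L \<Longrightarrow> x - y \<in> L"
    "x \<in> L \<Longrightarrow> y \<in> L \<Longrightarrow> x + y \<in> L" "x \<in> L \<Longrightarrow> y \<in> L \<Longrightarrow> x * y \<in> L"
    "x \<in> L \<Longrightarrow> y \<in> L \<Longrightarrow> x / y \<in> L" "x \<in> L \<Longrightarrow> x ^ n \<in> L" "numeral m \<in> L" "of_nat n \<in> L"
  using assms is_subringD[of L] is_subring_power[of L] is_subring_numeral[of L] is_subring_of_nat[of L]
  unfolding is_subfield_def divide_inverse by auto

text \<open>
  Substituting \<open>s = t + 1/\<sigma>\<close> makes the leading coefficient the square \<open>q\<^sup>2\<close>. With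
  \<open>y = q \<sigma>\<^sup>2 + A1 \<sigma> / (2 q) + h\<close> the equation of the quartic becomes quadratic in \<open>\<sigma>\<close>, and its
  discriminant is, for \<open>x = - 2 q h\<close>, the resolvent cubic divided by \<open>q\<^sup>2\<close>.
\<close>

lemma infinite_squares_of_resolvent:
  fixes A0 A1 A2 A3 A4 q t :: "'b :: field_char_0"
  assumes L: "is_subfield L" "q \<in> L" "t \<in> L" "A1 \<in> L" "A2 \<in> L" "A3 \<in> L" "A4 \<in> L"
    and q: "q \<noteq> 0" "q\<^sup>2 = A0"
    and g: "\<And>x. g (t + x) = A0 + A1 * x + A2 * x ^ 2 + A3 * x ^ 3 + A4 * x ^ 4"
    and inf: "infinite {x \<in> L. \<exists>y\<in>L. y\<^sup>2 = x ^ 3 + A2 * x\<^sup>2 + (A1 * A3 - 4 * A0 * A4) * x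
      + (A1\<^sup>2 * A4 + A0 * A3\<^sup>2 - 4 * A0 * A2 * A4)}" (is "infinite ?S")
  shows "infinite {s \<in> L. \<exists>v\<in>L. v\<^sup>2 = g s}"
proof -
  note Ld = is_subfieldD[OF L(1)]
  define e where "e = A1 / (2 * q)"
  have e: "A1 = 2 * q * e" "e \<in> L" using q L Ld by (auto simp: e_def)
  define R where "R = (\<lambda>\<sigma>. A0 * \<sigma> ^ 4 + A1 * \<sigma> ^ 3 + A2 * \<sigma> ^ 2 + A3 * \<sigma> + A4)"
  define T where "T = {\<sigma> \<in> L. \<exists>y\<in>L. y\<^sup>2 = R \<sigma>}"
  define f where "f = (\<lambda>(\<sigma>, y). - 2 * q * (y - q * \<sigma>\<^sup>2 - e * \<sigma>))"
  \<comment> \<open>At \<open>e^2 - A2\<close> the leading coefficient \<open>k\<close> of the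
    quadratic in \<open>\<sigma>\<close> vanishes; dropping this single value does no harm.\<close>
  have key: "\<exists>\<sigma> y. \<sigma> \<in> T \<and> y\<^sup>2 = R \<sigma> \<and> f (\<sigma>, y) = x" if x: "x \<in> ?S - {e\<^sup>2 - A2}" for x
  proof -
    obtain v where v: "v \<in> L" "v\<^sup>2 = x ^ 3 + A2 * x\<^sup>2 + (A1 * A3 - 4 * A0 * A4) * x
      + (A1\<^sup>2 * A4 + A0 * A3\<^sup>2 - 4 * A0 * A2 * A4)" using x by blast
    define h where "h = - x / (2 * q)"
    define k where "k = e\<^sup>2 - A2 - x"
    define \<sigma> where "\<sigma> = (A3 - 2 * e * h + v / q) / (2 * k)"
    define y where "y = q * \<sigma>\<^sup>2 + e * \<sigma> + h"
    have k: "k \<noteq> 0" using x by (auto simp: k_def)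
    have xh: "x = - 2 * q * h" using q by (simp add: h_def)
    have "(2 * k * \<sigma> + 2 * e * h - A3) = v / q" using k by (simp add: \<sigma>_def)
    then have sq: "(q * (2 * k * \<sigma> + 2 * e * h - A3))\<^sup>2 = v\<^sup>2" using q by simp
    have "v\<^sup>2 = q\<^sup>2 * ((2 * e * h - A3)\<^sup>2 - 4 * k * (h\<^sup>2 - A4))"
      unfolding v(2) k_def xh e(1) q(2)[symmetric] by Groebner_Basis.algebra
    then have "(4 * q\<^sup>2 * k) * (k * \<sigma>\<^sup>2 + (2 * e * h - A3) * \<sigma> + (h\<^sup>2 - A4)) = 0"
      using sq by Groebner_Basis.algebra
    then have quad: "k * \<sigma>\<^sup>2 + (2 * e * h - A3) * \<sigma> + (h\<^sup>2 - A4) = 0"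
      using k q(1) by simp
    have "y\<^sup>2 - R \<sigma> = k * \<sigma>\<^sup>2 + (2 * e * h - A3) * \<sigma> + (h\<^sup>2 - A4)"
      unfolding y_def R_def k_def xh e(1) q(2)[symmetric] by Groebner_Basis.algebra
    then have yR: "y\<^sup>2 = R \<sigma>" using quad by simp
    have xL: "x \<in> L" using x by blast
    have hL: "h \<in> L" unfolding h_def using xL L Ld by simp
    have "k \<in> L" unfolding k_def using xL e(2) L Ld by simp
    then have \<sigma>L: "\<sigma> \<in> L" unfolding \<sigma>_def using hL v(1) e(2) L Ld by simp
    have "y \<in> L" unfolding y_def using \<sigma>L hL e(2) L Ld by simp
    then have "\<sigma> \<in> T" using \<sigma>L yR by (auto simp: T_def)
    moreover have "f (\<sigma>, y) = x" by (simp add: f_def y_def xh)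
    ultimately show ?thesis using yR by blast
  qed
  \<comment> \<open>Each \<open>\<sigma>\<close> admits finitely many \<open>y\<close>, so
    infinitely many values \<open>f (\<sigma>, y)\<close> require infinitely many
    \<open>\<sigma>\<close>.\<close>
  have "infinite T"
  proof
    assume "finite T"
    moreover have "finite {y. y\<^sup>2 = R \<sigma>}" for \<sigma>
    proof -
      have "{y. y\<^sup>2 = R \<sigma>} = {y. poly [:- R \<sigma>, 0, 1:] y = 0}" by (auto simp: power2_eq_square)
      moreover have "finite \<dots>" by (rule poly_roots_finite) simp
      ultimately show ?thesis by metis
    qed
    ultimately have "finite (f ` (SIGMA \<sigma>:T. {y. y\<^sup>2 = R \<sigma>}))" by blast
    moreover have "?S - {e\<^sup>2 - A2} \<subseteq> f ` (SIGMA \<sigma>:T. {y. y\<^sup>2 = R \<sigma>})"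
    proof
      fix x assume "x \<in> ?S - {e\<^sup>2 - A2}"
      then obtain \<sigma> y where "\<sigma> \<in> T" "y\<^sup>2 = R \<sigma>" "f (\<sigma>, y) = x" using key by blast
      then show "x \<in> f ` (SIGMA \<sigma>:T. {y. y\<^sup>2 = R \<sigma>})" by (intro image_eqI[of _ _ "(\<sigma>, y)"]) auto
    qed
    ultimately have "finite (?S - {e\<^sup>2 - A2})" by (rule rev_finite_subset)
    then show False using inf by simp
  qed
  then have "infinite (T - {0})" by simp
  moreover have "inj_on (\<lambda>\<sigma>. t + 1 / \<sigma>) (T - {0})" by (auto simp: inj_on_def)
  ultimately have "infinite ((\<lambda>\<sigma>. t + 1 / \<sigma>) ` (T - {0}))" by (metis finite_imageD)
  then show ?thesis
  proof (rule infinite_super[rotated])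
    show "(\<lambda>\<sigma>. t + 1 / \<sigma>) ` (T - {0}) \<subseteq> {s \<in> L. \<exists>v\<in>L. v\<^sup>2 = g s}"
    proof
      fix s assume "s \<in> (\<lambda>\<sigma>. t + 1 / \<sigma>) ` (T - {0})"
      then obtain \<sigma> y where s: "s = t + 1 / \<sigma>" "\<sigma> \<in> L" "\<sigma> \<noteq> 0" "y \<in> L" "y\<^sup>2 = R \<sigma>"
        by (auto simp: T_def)
      have "(y / \<sigma>\<^sup>2)\<^sup>2 = R \<sigma> / \<sigma> ^ 4" using s by (simp add: power_divide flip: power_mult)
      also have "\<dots> = g s" unfolding s(1) g using s(3) by (simp add: R_def field_simps power_numeral_reduce)
      finally have "(y / \<sigma>\<^sup>2)\<^sup>2 = g s" .
      moreover have "y / \<sigma>\<^sup>2 \<in> L" using s(2,4) by (intro Ld)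
      moreover have "s \<in> L" unfolding s(1) using s(2) L(3) by (intro Ld)
      ultimately show "s \<in> {s \<in> L. \<exists>v\<in>L. v\<^sup>2 = g s}" by blast
    qed
  qed
qed

text \<open>The cubic is \<open>(x - r)^2 (x - r')\<close>, and \<open>y = n (x - r)\<close> gives
  \<open>x = r' + n^2\<close>. It remains to see that \<open>r\<close> and \<open>r'\<close> lie in
  \<open>L\<close>.\<close>

lemma infinite_points_singular_cubic:
  fixes C0 C1 C2 r r' :: "'b :: field_char_0"
  assumes L: "is_subfield L" "C0 \<in> L" "C1 \<in> L" "C2 \<in> L"
    and C: "C2 = - (2 * r + r')" "C1 = r\<^sup>2 + 2 * r * r'" "C0 = - (r\<^sup>2 * r')"
  shows "infinite {x \<in> L. \<exists>y\<in>L. y\<^sup>2 = x ^ 3 + C2 * x\<^sup>2 + C1 * x + C0}" (is "infinite ?S")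
proof -
  note Ld = is_subfieldD[OF L(1)]
  have r: "r \<in> L"
  proof (cases "r = r'")
    case True
    then have "r = - C2 / 3" by (simp add: C)
    then show ?thesis using Ld L by simp
  next
    case False
    \<comment> \<open>The double root is a zero of the remainder of 9 times the cubic modulo its
      derivative, which is linear with coefficients in \<open>L\<close>.\<close>
    have "2 * (C2\<^sup>2 - 3 * C1) * r = 9 * C0 - C1 * C2" unfolding C by Groebner_Basis.algebra
    moreover have "C2\<^sup>2 - 3 * C1 = (r - r')\<^sup>2" unfolding C by Groebner_Basis.algebra
    ultimately have "r = (9 * C0 - C1 * C2) / (2 * (C2\<^sup>2 - 3 * C1))" using False by (simp add: field_simps)
    then show ?thesis using Ld L by simp
  qed
  have "r' = - C2 - 2 * r" by (simp add: C)
  then have r': "r' \<in> L" using r Ld L by simp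
  have "r' + (of_nat n)\<^sup>2 \<in> ?S" for n
  proof -
    have "(of_nat n * (r' + (of_nat n)\<^sup>2 - r))\<^sup>2 = (r' + (of_nat n)\<^sup>2) ^ 3 + C2 * (r' + (of_nat n)\<^sup>2)\<^sup>2 + C1 * (r' + (of_nat n)\<^sup>2) + C0"
      unfolding C by Groebner_Basis.algebra
    moreover have "of_nat n * (r' + (of_nat n)\<^sup>2 - r) \<in> L" "r' + (of_nat n)\<^sup>2 \<in> L" using Ld r r' by auto
    ultimately show ?thesis by blast
  qed
  then have "range (\<lambda>n :: nat. r' + (of_nat n)\<^sup>2) \<subseteq> ?S" by blast
  moreover have "inj (\<lambda>n :: nat. r' + (of_nat n)\<^sup>2)"
  proof (rule injI)
    fix m n :: nat assume "r' + (of_nat m)\<^sup>2 = r' + (of_nat n)\<^sup>2"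
    then have "of_nat (m\<^sup>2) = (of_nat (n\<^sup>2) :: 'b)" by simp
    then have "m\<^sup>2 = n\<^sup>2" by (simp only: of_nat_eq_iff)
    then show "m = n" by simp
  qed
  ultimately show ?thesis using finite_subset finite_imageD infinite_UNIV_nat by blast
qed

text \<open>\<open>r\<close> is a root of the cubic; neither it nor \<open>a\<close>,
  \<open>b\<close> need lie in \<open>L\<close>. The shifted coordinates \<open>x + r\<close> stay
  in \<open>L\<close> because the tangent construction can be carried out on the cubic over
  \<open>L\<close>.\<close>

lemma infinite_points_of_orbit:
  fixes C0 C1 C2 r a b x\<^sub>0 :: "'b :: field_char_0"
  assumes L: "is_subfield L" "C0 \<in> L" "C1 \<in> L" "C2 \<in> L"
    and C: "C2 = a - 3 * r" "C1 = 3 * r\<^sup>2 - 2 * a * r + b" "C0 = - (r ^ 3) + a * r\<^sup>2 - b * r"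
    and pt: "x\<^sub>0 + r \<in> L" "Y\<^sub>0 \<in> L" "Y\<^sub>0\<^sup>2 = x\<^sub>0 * (x\<^sub>0\<^sup>2 + a * x\<^sub>0 + b)"
    and inf: "infinite (range (\<lambda>j. (dbl a b ^^ j) (Some x\<^sub>0)))"
  shows "infinite {x \<in> L. \<exists>y\<in>L. y\<^sup>2 = x ^ 3 + C2 * x\<^sup>2 + C1 * x + C0}" (is "infinite ?S")
proof -
  note Ld = is_subfieldD[OF L(1)]
  have cub: "(x + r) ^ 3 + C2 * (x + r)\<^sup>2 + C1 * (x + r) + C0 = x * (x\<^sup>2 + a * x + b)" for x
    unfolding C by Groebner_Basis.algebra
  have dbl_None: "dbl a b None = None" by (simp add: dbl_def isog_def)
  have orbit: "x + r \<in> L \<and> (\<exists>Y\<in>L. Y\<^sup>2 = x * (x\<^sup>2 + a * x + b))" if "(dbl a b ^^ j) (Some x\<^sub>0) = Some x" for j x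
    using that
  proof (induction j arbitrary: x)
    case 0
    then show ?case using pt by auto
  next
    case (Suc j)
    obtain x1 where x1: "(dbl a b ^^ j) (Some x\<^sub>0) = Some x1"
      using Suc.prems dbl_None by (cases "(dbl a b ^^ j) (Some x\<^sub>0)") auto
    obtain Y where Y: "Y \<in> L" "Y\<^sup>2 = x1 * (x1\<^sup>2 + a * x1 + b)" and x1L: "x1 + r \<in> L" using Suc.IH[OF x1] by blast
    have "dbl a b (Some x1) = Some x" using Suc.prems x1 by simp
    then have d: "x1 \<noteq> 0" "x1 + a + b / x1 \<noteq> 0"
      and x: "4 * x = (x1 + a + b / x1) + (- 2 * a) + (a\<^sup>2 - 4 * b) / (x1 + a + b / x1)"
      by (auto simp: dbl_def isog_def split: if_splits)
    define D where "D = x1\<^sup>2 + a * x1 + b"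
    have D: "x1 + a + b / x1 = D / x1" using d by (simp add: D_def field_simps power2_eq_square)
    have D0: "D \<noteq> 0" using d D by auto
    have "4 * x * (x1 * D) = D\<^sup>2 - 2 * a * x1 * D + (a\<^sup>2 - 4 * b) * x1\<^sup>2"
      unfolding x D using d D0 by (simp add: field_simps power2_eq_square)
    also have "\<dots> = (x1\<^sup>2 - b)\<^sup>2" unfolding D_def by Groebner_Basis.algebra
    finally have xD: "4 * x * Y\<^sup>2 = (x1\<^sup>2 - b)\<^sup>2" unfolding Y(2) D_def .
    have Y0: "Y \<noteq> 0" using Y(2) d D0 by (auto simp: D_def)
    define u where "u = x1 + r"
    have uL: "u \<in> L" using x1L by (simp add: u_def)
    \<comment> \<open>Slope of the tangent at \<open>(u, Y)\<close>. The duplication formula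
      \<open>xD\<close> identifies the third intersection of the tangent with the value of
      \<open>dbl\<close>.\<close>
    define m where "m = (3 * u\<^sup>2 + 2 * C2 * u + C1) / (2 * Y)"
    have mL: "m \<in> L" unfolding m_def using L(2-4) uL Y(1) by (intro Ld(4-10))
    have "2 * Y * m = 3 * u\<^sup>2 + 2 * C2 * u + C1" using Y0 by (simp add: m_def)
    also have "\<dots> = 3 * x1\<^sup>2 + 2 * a * x1 + b" unfolding C u_def by Groebner_Basis.algebra
    finally have m: "2 * Y * m = 3 * x1\<^sup>2 + 2 * a * x1 + b" .
    have "4 * Y\<^sup>2 * (m\<^sup>2 - a - 2 * x1) = (2 * Y * m)\<^sup>2 - 4 * (a + 2 * x1) * Y\<^sup>2" by Groebner_Basis.algebra
    also have "\<dots> = (x1\<^sup>2 - b)\<^sup>2" unfolding m Y(2) by Groebner_Basis.algebra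
    also have "\<dots> = 4 * Y\<^sup>2 * x" unfolding xD[symmetric] by (simp add: mult_ac)
    finally have xm: "x = m\<^sup>2 - a - 2 * x1" using Y0 by simp
    have "x + r = m\<^sup>2 - C2 - 2 * u" unfolding xm C u_def by simp
    moreover have "m\<^sup>2 - C2 - 2 * u \<in> L" using mL L(4) uL by (intro Ld)
    ultimately have xL: "x + r \<in> L" by simp
    define Z where "Z = Y + m * (x - x1)"
    have "Z = Y + m * (x + r - u)" by (simp add: Z_def u_def)
    then have "Z \<in> L" using Ld(5)[OF Y(1) Ld(6)[OF mL Ld(4)[OF xL uL]]] by simp
    moreover have "x * (x\<^sup>2 + a * x + b) - Z\<^sup>2 = (x1 * (x1\<^sup>2 + a * x1 + b) - Y\<^sup>2)
      + (3 * x1\<^sup>2 + 2 * a * x1 + b - 2 * Y * m) * (x - x1) + (x - x1)\<^sup>2 * (x - (m\<^sup>2 - a - 2 * x1))"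
      unfolding Z_def by Groebner_Basis.algebra
    then have "Z\<^sup>2 = x * (x\<^sup>2 + a * x + b)" using m Y(2) xm by simp
    ultimately show ?case using xL by blast
  qed
  define U where "U = {x. \<exists>j. (dbl a b ^^ j) (Some x\<^sub>0) = Some x}"
  have "range (\<lambda>j. (dbl a b ^^ j) (Some x\<^sub>0)) \<subseteq> insert None (Some ` U)"
  proof
    fix y assume "y \<in> range (\<lambda>j. (dbl a b ^^ j) (Some x\<^sub>0))"
    then obtain j where j: "(dbl a b ^^ j) (Some x\<^sub>0) = y" by blast
    show "y \<in> insert None (Some ` U)"
    proof (cases y)
      case (Some x)
      then have "x \<in> U" using j by (auto simp: U_def)
      then show ?thesis using Some by simp
    qed simp
  qed
  then have "infinite U" using inf finite_subset by blast
  then have "infinite ((\<lambda>x. x + r) ` U)" using finite_imageD[of "\<lambda>x. x + r" U] by (auto simp: inj_on_def)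
  moreover have "(\<lambda>x. x + r) ` U \<subseteq> ?S"
  proof
    fix y assume "y \<in> (\<lambda>x. x + r) ` U"
    then obtain x j where x: "y = x + r" "(dbl a b ^^ j) (Some x\<^sub>0) = Some x" by (auto simp: U_def)
    from orbit[OF x(2)] show "y \<in> ?S" unfolding x(1) mem_Collect_eq cub by blast
  qed
  ultimately show ?thesis using finite_subset by blast
qed

lemma factor_quartic:
  fixes g :: "'b :: alg_closed_field poly"
  assumes "Polynomial.degree g \<le> 4"
  shows "\<exists>l0 l1 l2 n0 n1 n2. g = [:l0, l1, l2:] * [:n0, n1, n2:]"
proof -
  have quad: "\<exists>n0 n1 n2. p = [:n0, n1, n2:]" if "Polynomial.degree p \<le> 2" for p :: "'b poly"
  proof (intro exI)
    show "p = [:Polynomial.coeff p 0, Polynomial.coeff p 1, Polynomial.coeff p 2:]"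
    proof (rule poly_eqI)
      fix i :: nat
      consider "i = 0" | "i = 1" | "i = 2" | "i > 2" by linarith
      then show "Polynomial.coeff p i = Polynomial.coeff [:Polynomial.coeff p 0, Polynomial.coeff p 1, Polynomial.coeff p 2:] i"
      proof cases
        case 4
        then have "Polynomial.coeff p i = 0" using that by (intro coeff_eq_0) simp
        then show ?thesis using 4 by (auto simp: coeff_pCons split: nat.splits)
      qed (simp_all add: numeral_2_eq_2)
    qed
  qed
  show ?thesis
  proof (cases "Polynomial.degree g \<le> 2")
    case True
    then obtain n0 n1 n2 where "g = [:n0, n1, n2:]" using quad by blast
    then have "g = [:1, 0, 0:] * [:n0, n1, n2:]" by simp
    then show ?thesis by blast
  next
    case False
    obtain r where "poly g r = 0" using alg_closed_imp_poly_has_root[of g] False by auto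
    then obtain g1 where g1: "g = [:- r, 1:] * g1" by (auto simp: poly_eq_0_iff_dvd dvd_def)
    have "g1 \<noteq> 0" using False g1 by auto
    then have d1: "Polynomial.degree g = Suc (Polynomial.degree g1)"
      unfolding g1 by (subst degree_mult_eq) auto
    obtain s where "poly g1 s = 0" using alg_closed_imp_poly_has_root[of g1] False d1 by auto
    then obtain g2 where g2: "g1 = [:- s, 1:] * g2" by (auto simp: poly_eq_0_iff_dvd dvd_def)
    have "g2 \<noteq> 0" using \<open>g1 \<noteq> 0\<close> g2 by auto
    then have "Polynomial.degree g1 = Suc (Polynomial.degree g2)"
      unfolding g2 by (subst degree_mult_eq) auto
    then obtain n0 n1 n2 where "g2 = [:n0, n1, n2:]" using quad[of g2] d1 assms by auto
    moreover have "g = [:s * r, - s - r, 1:] * g2" unfolding g1 g2 mult.assoc[symmetric] by simp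
    ultimately show ?thesis by blast
  qed
qed

text \<open>\<open>t\<close> is fixed before \<open>L\<close> and \<open>q\<close> because
  \<open>L\<close> will be generated by a square root of \<open>poly g t\<close>. The quadratic
  factors live over the closure, but \<open>t\<close> is a natural number and hence in
  \<open>F\<close>.\<close>

theorem infinite_squares_over_quadratic_extension:
  fixes g :: "'b :: {alg_closed_field, field_char_0} poly"
  assumes V: "dyadic_valuation_ring (V :: 'b set)"
    and g: "g \<noteq> 0" "Polynomial.degree g \<le> 4" "\<And>i. Polynomial.coeff g i \<in> F"
    and F: "is_subfield F"
  shows "\<exists>t\<in>F. \<forall>L q. is_subfield L \<and> F \<subseteq> L \<and> q \<in> L \<and> q\<^sup>2 = poly g t \<longrightarrow>
    infinite {s \<in> L. \<exists>v\<in>L. v\<^sup>2 = poly g s}"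
proof -
  obtain l0 l1 l2 n0 n1 n2 where gfac: "g = [:l0, l1, l2:] * [:n0, n1, n2:]"
    using factor_quartic[OF g(2)] by blast
  define a where "a = l1 * n1 - 2 * (l0 * n2 + l2 * n0)"
  define b where "b = (l0 * n2 - l2 * n0)\<^sup>2 - (l0 * n1 - l1 * n0) * (l1 * n2 - l2 * n1)"
  define p1 where "p1 = (\<lambda>t. l0 + l1 * t + l2 * t\<^sup>2)"
  define p2 where "p2 = (\<lambda>t. n0 + n1 * t + n2 * t\<^sup>2)"
  define w where "w = (\<lambda>t. (l0 + l1 * t + l2 * t\<^sup>2) * (n1 + 2 * n2 * t) - (l1 + 2 * l2 * t) * (n0 + n1 * t + n2 * t\<^sup>2))"
  have gt: "poly g t = p1 t * p2 t" for t
    unfolding gfac by (simp add: p1_def p2_def algebra_simps power2_eq_square)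
  define G where "G = Polynomial.coeff g"
  have G: "G 0 = l0 * n0" "G 1 = l0 * n1 + l1 * n0" "G 2 = l0 * n2 + l1 * n1 + l2 * n0"
    "G 3 = l1 * n2 + l2 * n1" "G 4 = l2 * n2"
    unfolding G_def gfac by (simp_all add: numeral_eq_Suc algebra_simps)
  obtain k :: nat where k: "poly g (of_nat k) \<noteq> 0"
    and orb: "b \<noteq> 0 \<and> a\<^sup>2 \<noteq> 4 * b \<longrightarrow>
      infinite (range (\<lambda>j. (dbl a b ^^ j) (Some ((w (of_nat k))\<^sup>2 / (4 * (p1 (of_nat k) * p2 (of_nat k)))))))"
  proof (cases "b \<noteq> 0 \<and> a\<^sup>2 \<noteq> 4 * b")
    case True
    have "\<exists>k :: nat. p1 (of_nat k) \<noteq> 0 \<and> p2 (of_nat k) \<noteq> 0 \<and>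
      infinite (range (\<lambda>j. (dbl a b ^^ j) (Some ((w (of_nat k))\<^sup>2 / (4 * (p1 (of_nat k) * p2 (of_nat k)))))))"
      unfolding a_def b_def p1_def p2_def w_def
      by (rule exists_infinite_orbit[OF V]) (use True in \<open>simp_all add: a_def b_def\<close>)
    then obtain k :: nat where "p1 (of_nat k) \<noteq> 0" "p2 (of_nat k) \<noteq> 0"
      "infinite (range (\<lambda>j. (dbl a b ^^ j) (Some ((w (of_nat k))\<^sup>2 / (4 * (p1 (of_nat k) * p2 (of_nat k)))))))"
      by blast
    then show ?thesis using that[of k] gt by simp
  next
    case False
    have "finite (of_nat -` {t. poly g t = 0} :: nat set)"
      by (rule finite_vimageI[OF poly_roots_finite[OF g(1)]]) (simp add: inj_of_nat)
    then obtain k where "poly g (of_nat k) \<noteq> 0"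
      using ex_new_if_finite[OF infinite_UNIV_nat] by blast
    then show ?thesis using that False by blast
  qed
  define t where "t = (of_nat k :: 'b)"
  have "infinite {s \<in> L. \<exists>v\<in>L. v\<^sup>2 = poly g s}"
    if L: "is_subfield L" and FL: "F \<subseteq> L" and q: "q \<in> L" "q\<^sup>2 = poly g t" for L q
  proof -
    note Ld = is_subfieldD[OF L]
    have tL: "t \<in> L" using Ld by (simp add: t_def)
    have GL: "G i \<in> L" for i using g(3) FL by (auto simp: G_def)
    \<comment> \<open>Taylor coefficients at \<open>t\<close> of the two factors, then of
      \<open>g\<close>. Those of \<open>g\<close> lie in \<open>L\<close> even when those of the
      factors do not.\<close>
    define a0 where "a0 = p1 t"
    define a1 where "a1 = l1 + 2 * l2 * t"
    define b0 where "b0 = p2 t"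
    define b1 where "b1 = n1 + 2 * n2 * t"
    define A0 where "A0 = a0 * b0"
    define A1 where "A1 = a0 * b1 + a1 * b0"
    define A2 where "A2 = a0 * n2 + a1 * b1 + l2 * b0"
    define A3 where "A3 = a1 * n2 + l2 * b1"
    define A4 where "A4 = l2 * n2"
    note Adefs = A0_def A1_def A2_def A3_def A4_def
    note adefs = a0_def a1_def b0_def b1_def p1_def p2_def
    have "A1 = G 1 + 2 * G 2 * t + 3 * G 3 * t\<^sup>2 + 4 * G 4 * t ^ 3"
      unfolding Adefs adefs G by Groebner_Basis.algebra
    then have A1L: "A1 \<in> L" using Ld GL tL by simp
    have "A2 = G 2 + 3 * G 3 * t + 6 * G 4 * t\<^sup>2"
      unfolding Adefs adefs G by Groebner_Basis.algebra
    then have A2L: "A2 \<in> L" using Ld GL tL by simp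
    have "A3 = G 3 + 4 * G 4 * t"
      unfolding Adefs adefs G by Groebner_Basis.algebra
    then have A3L: "A3 \<in> L" using Ld GL tL by simp
    have A4L: "A4 \<in> L" using GL[of 4] G by (simp add: A4_def)
    have q2: "q\<^sup>2 = A0" unfolding q(2) gt A0_def a0_def b0_def ..
    have A0L: "A0 \<in> L" using q q2 Ld by metis
    have A00: "A0 \<noteq> 0" using k unfolding gt A0_def a0_def b0_def t_def .
    have q0: "q \<noteq> 0" using q2 A00 by auto
    have taylor: "poly g (t + x) = A0 + A1 * x + A2 * x ^ 2 + A3 * x ^ 3 + A4 * x ^ 4" for x
      unfolding gt Adefs adefs by Groebner_Basis.algebra
    define C2 where "C2 = A2"
    define C1 where "C1 = A1 * A3 - 4 * A0 * A4"
    define C0 where "C0 = A1\<^sup>2 * A4 + A0 * A3\<^sup>2 - 4 * A0 * A2 * A4"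
    have CL: "C0 \<in> L" "C1 \<in> L" "C2 \<in> L" unfolding C0_def C1_def C2_def
      using A0L A1L A2L A3L A4L Ld by simp_all
    \<comment> \<open>The root of the resolvent cubic that belongs to this factorization.
      \<open>a\<close> and \<open>b\<close> are invariant under translation by \<open>t\<close>, so
      the orbit already found lives on this cubic shifted by \<open>r\<close>.\<close>
    define r where "r = - (a0 * n2 + l2 * b0)"
    have a': "a = a1 * b1 - 2 * (a0 * n2 + l2 * b0)"
      unfolding a_def adefs by Groebner_Basis.algebra
    have b': "b = (a0 * n2 - l2 * b0)\<^sup>2 - (a0 * b1 - a1 * b0) * (a1 * n2 - l2 * b1)"
      unfolding b_def adefs by Groebner_Basis.algebra
    have C: "C2 = a - 3 * r" "C1 = 3 * r\<^sup>2 - 2 * a * r + b" "C0 = - (r ^ 3) + a * r\<^sup>2 - b * r"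
      unfolding C0_def C1_def C2_def a' b' r_def Adefs by Groebner_Basis.algebra+
    have "infinite {x \<in> L. \<exists>y\<in>L. y\<^sup>2 = x ^ 3 + C2 * x\<^sup>2 + C1 * x + C0}"
    proof -
      consider "b = 0" | "a\<^sup>2 = 4 * b" | "b \<noteq> 0" "a\<^sup>2 \<noteq> 4 * b" by blast
      then show ?thesis
      proof cases
        \<comment> \<open>Relative to \<open>r\<close>, the roots of the cubic are 0, 0,
          \<open>- a\<close> here, and \<open>- a / 2\<close>, \<open>- a / 2\<close>, 0 in the next
          case.\<close>
        case 1
        show ?thesis
          by (rule infinite_points_singular_cubic[OF L CL, of r "r - a"])
            (simp_all add: C 1 algebra_simps power2_eq_square power3_eq_cube)
      next
        case 2
        then have "b = a\<^sup>2 / 4" by simp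
        then show ?thesis
          by (intro infinite_points_singular_cubic[OF L CL, of "r - a / 2" r])
            (simp_all add: C field_simps power2_eq_square power3_eq_cube)
      next
        case 3
        define x\<^sub>0 where "x\<^sub>0 = (w t)\<^sup>2 / (4 * A0)"
        have wt: "w t = a0 * b1 - a1 * b0" unfolding w_def adefs ..
        have "infinite (range (\<lambda>j. (dbl a b ^^ j) (Some x\<^sub>0)))"
          using orb 3 unfolding x\<^sub>0_def A0_def a0_def b0_def t_def by blast
        moreover have "(w t)\<^sup>2 = A1\<^sup>2 - 4 * A0 * (A2 + r)"
          unfolding wt Adefs r_def by Groebner_Basis.algebra
        then have x0r: "x\<^sub>0 + r = A1\<^sup>2 / (4 * A0) - A2"
          using A00 by (simp add: x\<^sub>0_def field_simps)
        moreover have "A1\<^sup>2 / (4 * A0) - A2 \<in> L" using A0L A1L A2L Ld by simp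
        \<comment> \<open>The value at which the quadratic in \<open>\<sigma>\<close> degenerates.
          It is the coordinate of \<open>(t, q)\<close> when \<open>(t, - q)\<close> is taken as the
          origin, and it annihilates the second product in the decomposition below, leaving a
          square.\<close>
        moreover define x1 where "x1 = A1\<^sup>2 / (4 * A0) - A2"
        define y where "y = A1 * x1 / (2 * q) + q * A3"
        have "y \<in> L" unfolding y_def x1_def using A0L A1L A2L A3L q Ld by simp
        moreover have "y\<^sup>2 = x\<^sub>0 * (x\<^sub>0\<^sup>2 + a * x\<^sub>0 + b)"
        proof -
          have "x\<^sub>0 * (x\<^sub>0\<^sup>2 + a * x\<^sub>0 + b) = (x\<^sub>0 + r) ^ 3 + C2 * (x\<^sub>0 + r)\<^sup>2 + C1 * (x\<^sub>0 + r) + C0"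
            unfolding C by Groebner_Basis.algebra
          also have "\<dots> = x1 ^ 3 + C2 * x1\<^sup>2 + C1 * x1 + C0" unfolding x0r x1_def ..
          also have "\<dots> = (A1 * x1 / (2 * q) + q * A3)\<^sup>2 + (x1 + A2 - A1\<^sup>2 / (4 * q\<^sup>2)) * (x1\<^sup>2 - 4 * q\<^sup>2 * A4)"
            unfolding C0_def C1_def C2_def q2[symmetric] using q0
            by (simp add: field_simps power2_eq_square power3_eq_cube)
          also have "x1 + A2 - A1\<^sup>2 / (4 * q\<^sup>2) = 0" unfolding x1_def q2 by simp
          finally show ?thesis unfolding y_def by simp
        qed
        ultimately show ?thesis
          using infinite_points_of_orbit[OF L CL C, of x\<^sub>0 y] by simp
      qed
    qed
    then show ?thesis
      using infinite_squares_of_resolvent[OF L q(1) tL A1L A2L A3L A4L q0 q2, of "poly g"] taylor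
      unfolding C0_def C1_def C2_def by (simp add: add.assoc)
  qed
  moreover have "t \<in> F" using is_subfieldD[OF F] by (simp add: t_def)
  ultimately show ?thesis by blast
qed

section \<open>Restricting a ternary form to a line\<close>

lemma eval3_superset:
  assumes "finite S" "Poly_Mapping.keys f \<subseteq> S"
  shows "eval3 f x y z = (\<Sum>(i, j, k)\<in>S. to_ac (Poly_Mapping.lookup f (i, j, k)) * x ^ i * y ^ j * z ^ k)"
  unfolding eval3_def using assms
  by (intro sum.mono_neutral_left) (auto simp: in_keys_iff)

lemma eval3_add: "eval3 (f + g) x y z = eval3 f x y z + eval3 g x y z"
proof -
  define S where "S = Poly_Mapping.keys f \<union> Poly_Mapping.keys g"
  have "finite S" "Poly_Mapping.keys f \<subseteq> S" "Poly_Mapping.keys g \<subseteq> S" "Poly_Mapping.keys (f + g) \<subseteq> S"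
    using Poly_Mapping.keys_add[of f g] by (auto simp: S_def)
  then show ?thesis
    by (simp add: eval3_superset[of S] lookup_add split_def distrib_right sum.distrib)
qed

lemma eval3_0 [simp]: "eval3 0 x y z = 0"
  by (simp add: eval3_def)

lemma eval3_sum: "eval3 (sum h I) x y z = (\<Sum>i\<in>I. eval3 (h i) x y z)"
  by (induction I rule: infinite_finite_induct) (auto simp: eval3_add)

lemma eval3_single: "eval3 (Poly_Mapping.single (i, j, k) c) x y z = to_ac c * x ^ i * y ^ j * z ^ k"
  by (subst eval3_superset[of "{(i, j, k)}"]) auto

lemma eval3_pderiv:
  "eval3 (pderiv_x f) x y z = (\<Sum>(i, j, k)\<in>Poly_Mapping.keys f.
     of_nat i * to_ac (Poly_Mapping.lookup f (i, j, k)) * x ^ (i - 1) * y ^ j * z ^ k)"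
  "eval3 (pderiv_y f) x y z = (\<Sum>(i, j, k)\<in>Poly_Mapping.keys f.
     of_nat j * to_ac (Poly_Mapping.lookup f (i, j, k)) * x ^ i * y ^ (j - 1) * z ^ k)"
  "eval3 (pderiv_z f) x y z = (\<Sum>(i, j, k)\<in>Poly_Mapping.keys f.
     of_nat k * to_ac (Poly_Mapping.lookup f (i, j, k)) * x ^ i * y ^ j * z ^ (k - 1))"
  unfolding pderiv_x_def pderiv_y_def pderiv_z_def eval3_sum
  by (intro sum.cong refl; clarsimp simp: eval3_single)+

lemma eval3_homogeneous:
  assumes "homogeneous3 d f"
  shows "eval3 f (c * x) (c * y) (c * z) = c ^ d * eval3 f x y z"
  unfolding eval3_def sum_distrib_left
proof (rule sum.cong, simp, clarify)
  fix i j k assume "(i, j, k) \<in> Poly_Mapping.keys f"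
  then have "d = i + j + k" using assms by (auto simp: homogeneous3_def)
  then show "to_ac (Poly_Mapping.lookup f (i, j, k)) * (c * x) ^ i * (c * y) ^ j * (c * z) ^ k =
    c ^ d * (to_ac (Poly_Mapping.lookup f (i, j, k)) * x ^ i * y ^ j * z ^ k)"
    by (simp add: power_mult_distrib power_add mult_ac)
qed

lemma homogeneous3_pderiv:
  assumes "homogeneous3 (Suc d) f"
  shows "homogeneous3 d (pderiv_x f)" "homogeneous3 d (pderiv_y f)" "homogeneous3 d (pderiv_z f)"
proof -
  have sum: "homogeneous3 d (sum h I)" if "\<And>i. i \<in> I \<Longrightarrow> homogeneous3 d (h i)" for h :: "nat \<times> nat \<times> nat \<Rightarrow> 'a poly3" and I
  proof -
    have "Poly_Mapping.keys (sum h I) \<subseteq> (\<Union>i\<in>I. Poly_Mapping.keys (h i))" by (rule Poly_Mapping.keys_sum)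
    then show ?thesis using that by (fastforce simp: homogeneous3_def)
  qed
  have pos: "n > 0" if "of_nat n * c \<noteq> 0" for n and c :: 'a
    using that by (cases n) auto
  have deg: "i + j + k = Suc d" if "(i, j, k) \<in> Poly_Mapping.keys f" for i j k
    using assms that by (auto simp: homogeneous3_def)
  show "homogeneous3 d (pderiv_x f)" unfolding pderiv_x_def
    by (rule sum) (auto simp: homogeneous3_def dest!: deg pos split: if_splits)
  show "homogeneous3 d (pderiv_y f)" unfolding pderiv_y_def
    by (rule sum) (auto simp: homogeneous3_def dest!: deg pos split: if_splits)
  show "homogeneous3 d (pderiv_z f)" unfolding pderiv_z_def
    by (rule sum) (auto simp: homogeneous3_def dest!: deg pos split: if_splits)
qed

lemma euler_identity:
  assumes "homogeneous3 d f"
  shows "x * eval3 (pderiv_x f) x y z + y * eval3 (pderiv_y f) x y z + z * eval3 (pderiv_z f) x y z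
    = of_nat d * eval3 f x y z"
  unfolding eval3_pderiv eval3_def[of f] sum_distrib_left sum.distrib[symmetric]
proof (rule sum.cong, simp, clarify)
  fix i j k assume "(i, j, k) \<in> Poly_Mapping.keys f"
  then have d: "d = i + j + k" using assms by (auto simp: homogeneous3_def)
  have pow: "u * (of_nat n * u ^ (n - 1)) = of_nat n * u ^ n" for u :: "'a alg_closure" and n
    by (cases n) auto
  define c where "c = to_ac (Poly_Mapping.lookup f (i, j, k))"
  have "x * (of_nat i * c * x ^ (i - 1) * y ^ j * z ^ k) + y * (of_nat j * c * x ^ i * y ^ (j - 1) * z ^ k) +
      z * (of_nat k * c * x ^ i * y ^ j * z ^ (k - 1))
    = x * (of_nat i * x ^ (i - 1)) * (c * y ^ j * z ^ k) + y * (of_nat j * y ^ (j - 1)) * (c * x ^ i * z ^ k)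
      + z * (of_nat k * z ^ (k - 1)) * (c * x ^ i * y ^ j)"
    by (simp add: mult_ac)
  also have "\<dots> = of_nat d * (c * x ^ i * y ^ j * z ^ k)"
    unfolding pow d by (simp add: algebra_simps)
  finally show "x * (of_nat i * to_ac (Poly_Mapping.lookup f (i, j, k)) * x ^ (i - 1) * y ^ j * z ^ k) +
      y * (of_nat j * to_ac (Poly_Mapping.lookup f (i, j, k)) * x ^ i * y ^ (j - 1) * z ^ k) +
      z * (of_nat k * to_ac (Poly_Mapping.lookup f (i, j, k)) * x ^ i * y ^ j * z ^ (k - 1))
    = of_nat d * (to_ac (Poly_Mapping.lookup f (i, j, k)) * x ^ i * y ^ j * z ^ k)"
    unfolding c_def .
qed

text \<open>Expanded as a formal polynomial, so that its coefficients can be located in a subfield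
  and its order of vanishing at 0 can be read off.\<close>

definition line_poly :: "'a :: field poly3 \<Rightarrow> 'a alg_closure \<Rightarrow> 'a alg_closure \<Rightarrow> 'a alg_closure
    \<Rightarrow> 'a alg_closure \<Rightarrow> 'a alg_closure \<Rightarrow> 'a alg_closure \<Rightarrow> 'a alg_closure poly" where
  "line_poly f x y z x' y' z' = (\<Sum>(i, j, k)\<in>Poly_Mapping.keys f.
     Polynomial.smult (to_ac (Poly_Mapping.lookup f (i, j, k))) ([:x, x':] ^ i * [:y, y':] ^ j * [:z, z':] ^ k))"

lemma poly_line_poly: "poly (line_poly f x y z x' y' z') s = eval3 f (x + s * x') (y + s * y') (z + s * z')"
  by (simp add: line_poly_def eval3_def poly_sum split_def poly_power mult_ac)

lemma degree_line_poly:
  assumes "homogeneous3 d f"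
  shows "Polynomial.degree (line_poly f x y z x' y' z') \<le> d"
  unfolding line_poly_def
proof (rule degree_sum_le, simp, clarify)
  fix i j k assume "(i, j, k) \<in> Poly_Mapping.keys f"
  then have d: "d = i + j + k" using assms by (auto simp: homogeneous3_def)
  have lin: "Polynomial.degree ([:u, v:] ^ n) \<le> n" for u v :: "'a alg_closure" and n
    using degree_power_le[of "[:u, v:]" n] by (simp split: if_splits)
  have "Polynomial.degree ([:x, x':] ^ i * [:y, y':] ^ j * [:z, z':] ^ k) \<le> i + j + k"
    by (intro order.trans[OF degree_mult_le] add_mono lin)
  then show "Polynomial.degree (Polynomial.smult (to_ac (Poly_Mapping.lookup f (i, j, k)))
      ([:x, x':] ^ i * [:y, y':] ^ j * [:z, z':] ^ k)) \<le> d"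
    unfolding d by (rule order.trans[OF degree_smult_le])
qed

lemma coeff_mult_mem:
  assumes "is_subring F" "\<And>i. Polynomial.coeff p i \<in> F" "\<And>i. Polynomial.coeff q i \<in> F"
  shows "Polynomial.coeff (p * q) i \<in> F"
  unfolding coeff_mult using assms by (intro is_subring_sum is_subringD(6)) auto

lemma coeff_power_mem:
  assumes "is_subring F" "\<And>i. Polynomial.coeff p i \<in> F"
  shows "Polynomial.coeff (p ^ n) i \<in> F"
proof (induction n arbitrary: i)
  case 0
  then show ?case using is_subringD[OF assms(1)] by simp
next
  case (Suc n)
  then show ?case unfolding power_Suc using assms by (intro coeff_mult_mem) auto
qed

lemma coeff_line_poly_mem:
  assumes F: "is_subring F" "range to_ac \<subseteq> F" and "x \<in> F" "y \<in> F" "z \<in> F" "x' \<in> F" "y' \<in> F" "z' \<in> F"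
  shows "Polynomial.coeff (line_poly f x y z x' y' z') n \<in> F"
proof -
  have lin: "Polynomial.coeff [:u, v:] i \<in> F" if "u \<in> F" "v \<in> F" for u v i
    using that is_subringD[OF F(1)] by (auto simp: coeff_pCons split: nat.splits)
  have "Polynomial.coeff (Polynomial.smult (to_ac c) ([:x, x':] ^ i * [:y, y':] ^ j * [:z, z':] ^ k)) n \<in> F"
    for c i j k
    unfolding coeff_smult using assms
    by (intro is_subringD(6)[OF F(1)] coeff_mult_mem coeff_power_mem lin) auto
  then show ?thesis
    unfolding line_poly_def coeff_sum by (intro is_subring_sum[OF F(1)]) auto
qed

text \<open>The chain rule at \<open>s = 0\<close>; the directions tangent to the curve are those
  that make this coefficient vanish.\<close>

lemma coeff_1_line_poly:
  "Polynomial.coeff (line_poly f x y z x' y' z') 1 =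
    x' * eval3 (pderiv_x f) x y z + y' * eval3 (pderiv_y f) x y z + z' * eval3 (pderiv_z f) x y z"
proof -
  have c0: "Polynomial.coeff ([:u, v:] ^ n) 0 = u ^ n" for u v :: "'a alg_closure" and n
    by (simp add: coeff_0_power)
  have c1: "Polynomial.coeff ([:u, v:] ^ n) 1 = v * (of_nat n * u ^ (n - 1))" for u v :: "'a alg_closure" and n
  proof (induction n)
    case (Suc n)
    have "Polynomial.coeff ([:u, v:] ^ Suc n) 1 = u * Polynomial.coeff ([:u, v:] ^ n) 1 + v * Polynomial.coeff ([:u, v:] ^ n) 0"
      by (simp add: coeff_mult)
    also have "\<dots> = v * (of_nat (Suc n) * u ^ n)"
      unfolding Suc c0 by (cases n) (simp_all add: algebra_simps)
    finally show ?case by simp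
  qed simp
  have m1: "Polynomial.coeff (p * q) 1 = Polynomial.coeff p 0 * Polynomial.coeff q 1 + Polynomial.coeff p 1 * Polynomial.coeff q 0"
    for p q :: "'a alg_closure poly" by (simp add: coeff_mult)
  have "Polynomial.coeff (Polynomial.smult c ([:x, x':] ^ i * [:y, y':] ^ j * [:z, z':] ^ k)) 1
    = x' * (of_nat i * c * x ^ (i - 1) * y ^ j * z ^ k) + y' * (of_nat j * c * x ^ i * y ^ (j - 1) * z ^ k)
      + z' * (of_nat k * c * x ^ i * y ^ j * z ^ (k - 1))" for c i j k
    unfolding coeff_smult m1 coeff_mult_0 c0 c1 by (simp add: algebra_simps)
  then show ?thesis
    unfolding line_poly_def coeff_sum eval3_pderiv sum_distrib_left sum.distrib[symmetric]
    by (simp add: split_def)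
qed

lemma poly_eqI_nonzero:
  fixes p q :: "'b :: field_char_0 poly"
  assumes "\<And>s. s \<noteq> 0 \<Longrightarrow> poly p s = poly q s"
  shows "p = q"
proof (rule ccontr)
  assume "p \<noteq> q"
  then have "finite {s. poly (p - q) s = 0}" by (intro poly_roots_finite) simp
  moreover have "UNIV - {0} \<subseteq> {s. poly (p - q) s = 0}" using assms by auto
  ultimately have "finite (UNIV - {0 :: 'b})" by (rule rev_finite_subset)
  then show False using infinite_UNIV_char_0[where ?'a = 'b] by simp
qed

text \<open>Exchanging base point and direction gives the reciprocal polynomial and makes the point
  at infinite parameter accessible.\<close>

lemma line_poly_swap:
  assumes "homogeneous3 d f" "s \<noteq> 0"
  shows "poly (line_poly f x' y' z' x y z) s = s ^ d * poly (line_poly f x y z x' y' z') (inverse s)"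
proof -
  have "poly (line_poly f x' y' z' x y z) s
    = eval3 f (s * (x + inverse s * x')) (s * (y + inverse s * y')) (s * (z + inverse s * z'))"
    using assms(2) by (simp add: poly_line_poly distrib_left add.commute flip: mult.assoc)
  then show ?thesis unfolding eval3_homogeneous[OF assms(1)] poly_line_poly .
qed

section \<open>A smooth curve of degree above 1 contains no line\<close>

definition independent3 :: "'b :: field \<Rightarrow> 'b \<Rightarrow> 'b \<Rightarrow> 'b \<Rightarrow> 'b \<Rightarrow> 'b \<Rightarrow> bool" where
  "independent3 x y z x' y' z' \<longleftrightarrow> y * z' - z * y' \<noteq> 0 \<or> z * x' - x * z' \<noteq> 0 \<or> x * y' - y * x' \<noteq> 0"

lemma independent3_combination:
  assumes "independent3 x y z x' y' z'"
    and "c * x + d * x' = 0" "c * y + d * y' = 0" "c * z + d * z' = 0"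
  shows "c = 0" "d = 0"
proof -
  have "c * (y * z' - z * y') = 0" "c * (z * x' - x * z') = 0" "c * (x * y' - y * x') = 0"
    "d * (y * z' - z * y') = 0" "d * (z * x' - x * z') = 0" "d * (x * y' - y * x') = 0"
    using assms(2-4) by Groebner_Basis.algebra+
  then show "c = 0" "d = 0" using assms(1) by (auto simp: independent3_def)
qed

text \<open>Without a root at a finite parameter the restriction is a constant \<open>c\<close>. The
  reversed restriction is then \<open>c * s ^ d\<close>, which vanishes at 0, so the zero sits at
  infinity.\<close>

lemma homogeneous_form_vanishes_on_line:
  fixes f :: "'a :: field_char_0 poly3"
  assumes f: "homogeneous3 d f" "d > 0"
  shows "(\<exists>s. eval3 f (x + s * x') (y + s * y') (z + s * z') = 0) \<or> eval3 f x' y' z' = 0"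
proof (rule ccontr)
  assume neg: "\<not> ?thesis"
  define p where "p = line_poly f x y z x' y' z'"
  have "poly p s \<noteq> 0" for s using neg by (simp add: p_def poly_line_poly)
  then have "Polynomial.degree p = 0" using alg_closed_imp_poly_has_root[of p] by auto
  then obtain c where c: "p = [:c:]" by (rule degree_eq_zeroE)
  have "line_poly f x' y' z' x y z = Polynomial.monom c d"
  proof (rule poly_eqI_nonzero)
    fix s :: "'a alg_closure" assume s: "s \<noteq> 0"
    show "poly (line_poly f x' y' z' x y z) s = poly (Polynomial.monom c d) s"
      using line_poly_swap[OF f(1) s, of x' y' z' x y z] by (simp add: c poly_monom flip: p_def)
  qed
  then have "poly (line_poly f x' y' z' x y z) 0 = 0" using f(2) by (simp add: poly_monom)
  then show False using neg by (simp add: poly_line_poly)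
qed

text \<open>Along a line inside the curve, the gradient is orthogonal to both spanning vectors and
  hence a multiple of their cross product. One component, a form of positive degree
  \<open>d\<close>, has a zero on the line, and there the whole gradient vanishes.\<close>

lemma smooth_curve_contains_no_line:
  fixes f :: "'a :: field_char_0 poly3"
  assumes f: "homogeneous3 (Suc d) f" "d > 0" "smooth_plane_curve f"
    and ind: "independent3 x y z x' y' z'"
  shows "line_poly f x y z x' y' z' \<noteq> 0"
proof
  assume zero: "line_poly f x y z x' y' z' = 0"
  have sw: "line_poly f x' y' z' x y z = 0"
  proof (rule poly_eqI_nonzero)
    fix s :: "'a alg_closure" assume s: "s \<noteq> 0"
    show "poly (line_poly f x' y' z' x y z) s = poly 0 s"
      using line_poly_swap[OF f(1) s, of x' y' z' x y z] by (simp add: zero)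
  qed
  define on_line where "on_line = (\<lambda>u v w. (\<exists>s. u = x + s * x' \<and> v = y + s * y' \<and> w = z + s * z') \<or>
     (u = x' \<and> v = y' \<and> w = z'))"
  have perp: "eval3 f u v w = 0 \<and> (u, v, w) \<noteq> (0, 0, 0) \<and>
      x * eval3 (pderiv_x f) u v w + y * eval3 (pderiv_y f) u v w + z * eval3 (pderiv_z f) u v w = 0 \<and>
      x' * eval3 (pderiv_x f) u v w + y' * eval3 (pderiv_y f) u v w + z' * eval3 (pderiv_z f) u v w = 0"
    if ol: "on_line u v w" for u v w
  proof -
    define Gx where "Gx = eval3 (pderiv_x f) u v w"
    define Gy where "Gy = eval3 (pderiv_y f) u v w"
    define Gz where "Gz = eval3 (pderiv_z f) u v w"
    have main: "eval3 f u v w = 0 \<and> (u, v, w) \<noteq> (0, 0, 0) \<and> x * Gx + y * Gy + z * Gz = 0 \<and> x' * Gx + y' * Gy + z' * Gz = 0"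
      using ol unfolding on_line_def
    proof
      assume "\<exists>s. u = x + s * x' \<and> v = y + s * y' \<and> w = z + s * z'"
      then obtain s where s: "u = x + s * x'" "v = y + s * y'" "w = z + s * z'" by blast
      have f0: "eval3 f u v w = 0" using zero poly_line_poly[of f x y z x' y' z' s] by (simp add: s)
      have "line_poly f u v w x' y' z' = 0"
      proof (rule poly_eqI_nonzero)
        fix r :: "'a alg_closure"
        have "poly (line_poly f u v w x' y' z') r = poly (line_poly f x y z x' y' z') (s + r)"
          unfolding poly_line_poly s by (simp add: algebra_simps)
        then show "poly (line_poly f u v w x' y' z') r = poly 0 r" using zero by simp
      qed
      then have D: "x' * Gx + y' * Gy + z' * Gz = 0"
        using coeff_1_line_poly[of f u v w x' y' z'] by (simp add: Gx_def Gy_def Gz_def)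
      have "u * Gx + v * Gy + w * Gz = 0"
        using euler_identity[OF f(1), of u v w] f0 by (simp add: Gx_def Gy_def Gz_def)
      then have "x * Gx + y * Gy + z * Gz + s * (x' * Gx + y' * Gy + z' * Gz) = 0"
        unfolding s by (simp add: algebra_simps)
      moreover have "(u, v, w) \<noteq> (0, 0, 0)"
        using independent3_combination(1)[OF ind, of 1 s] by (auto simp: s)
      ultimately show ?thesis using D f0 by simp
    next
      assume s: "u = x' \<and> v = y' \<and> w = z'"
      have f0: "eval3 f u v w = 0" using sw poly_line_poly[of f x' y' z' x y z 0] by (simp add: s)
      have "x * Gx + y * Gy + z * Gz = 0"
        using coeff_1_line_poly[of f x' y' z' x y z] sw by (simp add: Gx_def Gy_def Gz_def s)
      moreover have "u * Gx + v * Gy + w * Gz = 0"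
        using euler_identity[OF f(1), of u v w] f0 by (simp add: Gx_def Gy_def Gz_def)
      moreover have "(u, v, w) \<noteq> (0, 0, 0)"
        using independent3_combination(2)[OF ind, of 0 1] by (auto simp: s)
      ultimately show ?thesis using f0 s by simp
    qed
    then show ?thesis unfolding Gx_def Gy_def Gz_def .
  qed
  have nonsing: "eval3 (pderiv_x f) u v w \<noteq> 0 \<or> eval3 (pderiv_y f) u v w \<noteq> 0 \<or> eval3 (pderiv_z f) u v w \<noteq> 0"
    if "on_line u v w" for u v w
    using f(3) perp[OF that] unfolding smooth_plane_curve_def by blast
  have root: "\<exists>u v w. on_line u v w \<and> eval3 h u v w = 0" if "homogeneous3 d h" for h
    using homogeneous_form_vanishes_on_line[OF that f(2), of x x' y y' z z'] unfolding on_line_def by blast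
  \<comment> \<open>A nonzero coordinate of the cross product tells which partial derivative to make
    vanish; the other two then vanish with it.\<close>
  show False
    using ind unfolding independent3_def
  proof (elim disjE)
    assume n: "y * z' - z * y' \<noteq> 0"
    obtain u v w where uvw: "on_line u v w" "eval3 (pderiv_x f) u v w = 0"
      using root[OF homogeneous3_pderiv(1)[OF f(1)]] by blast
    define Gy where "Gy = eval3 (pderiv_y f) u v w"
    define Gz where "Gz = eval3 (pderiv_z f) u v w"
    have "y * Gy + z * Gz = 0" "y' * Gy + z' * Gz = 0" using perp[OF uvw(1)] uvw(2) by (simp_all add: Gy_def Gz_def)
    then have "(y * z' - z * y') * Gy = 0" "(y * z' - z * y') * Gz = 0" by Groebner_Basis.algebra+
    then have "Gy = 0" "Gz = 0" using n by simp_all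
    then show False using nonsing[OF uvw(1)] uvw(2) by (simp add: Gy_def Gz_def)
  next
    assume n: "z * x' - x * z' \<noteq> 0"
    obtain u v w where uvw: "on_line u v w" "eval3 (pderiv_y f) u v w = 0"
      using root[OF homogeneous3_pderiv(2)[OF f(1)]] by blast
    define Gx where "Gx = eval3 (pderiv_x f) u v w"
    define Gz where "Gz = eval3 (pderiv_z f) u v w"
    have "x * Gx + z * Gz = 0" "x' * Gx + z' * Gz = 0" using perp[OF uvw(1)] uvw(2) by (simp_all add: Gx_def Gz_def)
    then have "(z * x' - x * z') * Gx = 0" "(z * x' - x * z') * Gz = 0" by Groebner_Basis.algebra+
    then have "Gx = 0" "Gz = 0" using n by simp_all
    then show False using nonsing[OF uvw(1)] uvw(2) by (simp add: Gx_def Gz_def)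
  next
    assume n: "x * y' - y * x' \<noteq> 0"
    obtain u v w where uvw: "on_line u v w" "eval3 (pderiv_z f) u v w = 0"
      using root[OF homogeneous3_pderiv(3)[OF f(1)]] by blast
    define Gx where "Gx = eval3 (pderiv_x f) u v w"
    define Gy where "Gy = eval3 (pderiv_y f) u v w"
    have "x * Gx + y * Gy = 0" "x' * Gx + y' * Gy = 0" using perp[OF uvw(1)] uvw(2) by (simp_all add: Gx_def Gy_def)
    then have "(x * y' - y * x') * Gx = 0" "(x * y' - y * x') * Gy = 0" by Groebner_Basis.algebra+
    then have "Gx = 0" "Gy = 0" using n by simp_all
    then show False using nonsing[OF uvw(1)] uvw(2) by (simp add: Gx_def Gy_def)
  qed
qed

section \<open>Field extensions and the valuation ring above 2\<close>

abbreviation type_ring :: "'b :: field ring" where "type_ring \<equiv> ring_of_type_algebra"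

lemma type_ring_simps [simp]:
  "carrier (type_ring :: 'b :: field ring) = UNIV"
  "monoid.mult (type_ring :: 'b ring) = (*)" "one (type_ring :: 'b ring) = 1"
  "ring.zero (type_ring :: 'b ring) = 0" "add (type_ring :: 'b ring) = (+)"
  by (simp_all add: ring_of_type_algebra_def)

lemma type_ring_uminus [simp]: "a_inv (type_ring :: 'b :: field ring) x = - x"
proof -
  interpret R: field "type_ring :: 'b ring" by (rule field_from_type_algebra)
  have "a_inv type_ring (x :: 'b) + x = 0" using R.l_neg[of x] by simp
  then show ?thesis by (simp add: eq_neg_iff_add_eq_0)
qed

lemma type_ring_m_inv: "x \<noteq> 0 \<Longrightarrow> m_inv (type_ring :: 'b :: field ring) x = inverse x"
proof -
  interpret R: field "type_ring :: 'b ring" by (rule field_from_type_algebra)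
  assume "x \<noteq> 0"
  then show ?thesis by (intro R.comm_inv_char) auto
qed

lemma type_ring_pow [simp]: "x [^]\<^bsub>(type_ring :: 'b :: field ring)\<^esub> (n :: nat) = x ^ n"
proof -
  interpret R: field "type_ring :: 'b ring" by (rule field_from_type_algebra)
  show ?thesis by (induction n) (simp_all add: mult.commute)
qed

lemma type_ring_eval: "ring.eval (type_ring :: 'b :: field ring) cs x = poly (Poly (rev cs)) x"
proof -
  interpret R: field "type_ring :: 'b ring" by (rule field_from_type_algebra)
  show ?thesis
    by (induction cs) (simp_all add: Poly_append poly_monom)
qed

lemma subfield_type_ring_iff: "subfield L (type_ring :: 'b :: field ring) \<longleftrightarrow> is_subfield L"
proof
  interpret R: field "type_ring :: 'b ring" by (rule field_from_type_algebra)
  assume L: "subfield L (type_ring :: 'b ring)"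
  note r = subringE[OF subfieldE(1)[OF L], simplified]
  have "x - y \<in> L" if "x \<in> L" "y \<in> L" for x y using r(7)[OF that(1) r(5)[OF that(2)]] by simp
  moreover have "inverse x \<in> L" if "x \<in> L" for x
  proof (cases "x = 0")
    case False
    then show ?thesis using R.subfield_m_inv(1)[OF L, of x] that by (simp add: type_ring_m_inv)
  qed (use r in simp)
  ultimately show "is_subfield L" using r by (auto simp: is_subfield_def is_subring_def)
next
  interpret R: field "type_ring :: 'b ring" by (rule field_from_type_algebra)
  assume L: "is_subfield L"
  note Ld = is_subfieldD[OF L]
  have "subring L type_ring" by (rule R.subringI) (use Ld in auto)
  then show "subfield L (type_ring :: 'b ring)"
    by (rule R.subfieldI') (use L in \<open>auto simp: type_ring_m_inv is_subfield_def\<close>)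
qed

lemma is_subfield_range_to_ac: "is_subfield (range (to_ac :: 'a :: field \<Rightarrow> 'a alg_closure))"
  unfolding is_subfield_def is_subring_def
  by (auto simp flip: to_ac_diff to_ac_mult to_ac_inverse to_ac_1)

text \<open>\<open>p\<close> may be reducible, so the degree is that of the minimal polynomial of
  \<open>x\<close>, which divides \<open>p\<close>.\<close>

lemma exists_simple_extension:
  fixes F :: "'b :: field set"
  assumes F: "is_subfield F" and p: "p \<noteq> 0" "\<And>i. Polynomial.coeff p i \<in> F" "poly p x = 0"
  shows "\<exists>E n. is_subfield E \<and> F \<subseteq> E \<and> x \<in> E \<and> n \<le> Polynomial.degree p \<and> ring.dimension type_ring n F E"
proof -
  interpret R: field "type_ring :: 'b ring" by (rule field_from_type_algebra)
  have Fs: "subfield F type_ring" using F subfield_type_ring_iff by blast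
  have Fr: "subring F type_ring" using subfieldE(1)[OF Fs] .
  define P where "P = rev (coeffs p)"
  have P0: "P \<noteq> []" using p(1) by (simp add: P_def)
  have "hd P \<noteq> 0" using p(1) by (simp add: P_def hd_rev last_coeffs_eq_coeff_degree)
  moreover have "set P \<subseteq> F" using p(2) by (auto simp: P_def coeffs_def)
  ultimately have P: "P \<in> carrier (F[X]\<^bsub>type_ring\<^esub>)"
    using P0 by (simp add: univ_poly_def polynomial_def)
  have ev: "R.eval P x = \<zero>\<^bsub>type_ring\<^esub>" using p(3) by (simp add: type_ring_eval P_def)
  have alg: "(R.algebraic over F) x" using R.algebraicI[OF P P0 ev] .
  have x: "x \<in> carrier type_ring" by simp
  have "Polynomials.degree (R.Irr F x) \<le> Polynomials.degree P"
    using R.pdivides_imp_degree_le[OF Fr R.IrrE(1)[OF Fs x alg] P P0] R.Irr_minimal[OF Fs x alg P ev] by blast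
  also have "\<dots> = Polynomial.degree p" by (simp add: P_def degree_eq_length_coeffs)
  finally have deg: "Polynomials.degree (R.Irr F x) \<le> Polynomial.degree p" .
  have "is_subfield (R.simple_extension F x)"
    using R.simple_extension_is_subfield[OF Fs x] alg subfield_type_ring_iff by blast
  moreover have "F \<subseteq> R.simple_extension F x" using R.simple_extension_incl[of F x] by simp
  moreover have "x \<in> R.simple_extension F x" using R.simple_extension_mem[OF Fr x] .
  ultimately show ?thesis using R.dimension_simple_extension[OF Fs x alg] deg by blast
qed

lemma finite_extension_tower:
  fixes E L :: "'a :: field alg_closure set"
  assumes "is_subfield E" "range to_ac \<subseteq> E" "ring.dimension type_ring m (range to_ac) E"
    and "is_subfield L" "E \<subseteq> L" "ring.dimension type_ring n E L"
  shows "finite_extension L" "ext_degree L = m * n"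
proof -
  interpret R: field "type_ring :: 'a alg_closure ring" by (rule field_from_type_algebra)
  have K: "subfield (range to_ac) (type_ring :: 'a alg_closure ring)"
    using is_subfield_range_to_ac subfield_type_ring_iff by blast
  have E: "subfield E type_ring" and L: "subfield L type_ring"
    using assms subfield_type_ring_iff by blast+
  have d: "R.dimension (m * n) (range to_ac) L"
    using R.telescopic_base[OF K E assms(3,6)] .
  then show "finite_extension L"
    unfolding finite_extension_def using L assms R.finite_dimensionI by blast
  show "ext_degree L = m * n"
    using R.dimI[OF K d] unfolding ext_degree_def over_def .
qed

section \<open>The valuation ring above 2 in the closure of a number field\<close>

lemma valuation_ring_integrally_closed:
  assumes B: "is_subring B" "\<And>x. x \<in> B \<or> inverse x \<in> B"
    and p: "p \<noteq> 0" "\<And>i. Polynomial.coeff p i \<in> B" "inverse (Polynomial.lead_coeff p) \<in> B" "poly p x = 0"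
  shows "x \<in> B"
proof (rule ccontr)
  assume x: "x \<notin> B"
  note Bd = is_subringD[OF B(1)]
  have w: "inverse x \<in> B" "x \<noteq> 0" using B(2)[of x] x Bd by auto
  define n where "n = Polynomial.degree p"
  define c where "c = Polynomial.lead_coeff p"
  have c: "c \<noteq> 0" "inverse c \<in> B" using p by (simp_all add: c_def)
  have "n \<noteq> 0"
  proof
    assume "n = 0"
    then obtain d where "p = [:d:]" unfolding n_def by (rule degree_eq_zeroE)
    then show False using p(1,4) by simp
  qed
  then obtain m where m: "n = Suc m" by (cases n) auto
  have "0 = (\<Sum>i\<le>Suc m. Polynomial.coeff p i * x ^ i)" using p(4) m by (simp add: poly_altdef n_def)
  also have "\<dots> = (\<Sum>i\<le>m. Polynomial.coeff p i * x ^ i) + c * x ^ Suc m"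
    using m by (simp add: c_def n_def)
  finally have "c * x ^ Suc m = - (\<Sum>i\<le>m. Polynomial.coeff p i * x ^ i)"
    by (simp add: eq_neg_iff_add_eq_0 add.commute)
  \<comment> \<open>With \<open>m\<close> one below the degree, this leaves \<open>c * x\<close> on
    the left and only nonnegative powers of \<open>inverse x\<close>, an element of
    \<open>B\<close>, on the right.\<close>
  then have "inverse x ^ m * (c * x ^ Suc m) = - (\<Sum>i\<le>m. inverse x ^ m * (Polynomial.coeff p i * x ^ i))"
    by (simp add: sum_distrib_left)
  also have "inverse x ^ m * (c * x ^ Suc m) = c * x" using w by (simp add: field_simps)
  also have "(\<Sum>i\<le>m. inverse x ^ m * (Polynomial.coeff p i * x ^ i)) = (\<Sum>i\<le>m. Polynomial.coeff p i * inverse x ^ (m - i))"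
  proof (rule sum.cong)
    fix i assume "i \<in> {..m}"
    then have "inverse x ^ m = inverse x ^ (m - i) * inverse x ^ i" by (simp flip: power_add)
    then show "inverse x ^ m * (Polynomial.coeff p i * x ^ i) = Polynomial.coeff p i * inverse x ^ (m - i)"
      using w by (simp add: field_simps)
  qed simp
  finally have "x = inverse c * - (\<Sum>i\<le>m. Polynomial.coeff p i * inverse x ^ (m - i))"
    using c by (simp add: field_simps)
  also have "\<dots> \<in> B"
    using p(2) w(1) by (intro Bd(6)[OF c(2)] Bd(3) is_subring_sum[OF B(1)] Bd(6) is_subring_power[OF B(1)]) auto
  finally show False using x by simp
qed

lemma to_ac_of_rat: "to_ac (of_rat r :: 'a :: field_char_0) = of_rat r"
  by (cases r) (simp add: of_rat_rat)

lemma poly_map_poly_to_ac: "poly (map_poly to_ac p) (to_ac x) = to_ac (poly p x)"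
  by (induction p) (simp_all add: map_poly_pCons)

lemma number_field_algebraic:
  fixes x :: "'a :: field_char_0"
  assumes "number_field TYPE('a)"
  shows "\<exists>p :: 'a poly. p \<noteq> 0 \<and> (\<forall>i. Polynomial.coeff p i \<in> range of_rat) \<and> poly p x = 0"
proof -
  interpret R: field "type_ring :: 'a ring" by (rule field_from_type_algebra)
  have "is_subfield (range (of_rat :: rat \<Rightarrow> 'a))"
    unfolding is_subfield_def is_subring_def
    by (auto simp flip: of_rat_diff of_rat_mult of_rat_inverse intro: range_eqI[of _ _ 1])
  then have Q: "subfield (range (of_rat :: rat \<Rightarrow> 'a)) type_ring" using subfield_type_ring_iff by blast
  have "(R.algebraic over range of_rat) x"
    using R.finite_dimension_imp_algebraic[OF Q R.carrier_is_subring] assms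
    unfolding number_field_def by simp
  then obtain P where P: "P \<in> carrier (range of_rat[X]\<^bsub>type_ring\<^esub>)" "P \<noteq> []" "R.eval P x = 0"
    using R.algebraicE[OF subfieldE(1)[OF Q], of x] by auto
  have hd: "hd P \<noteq> 0" and set: "set P \<subseteq> range of_rat"
    using P(1,2) by (auto simp: univ_poly_def polynomial_def)
  define p where "p = Poly (rev P)"
  have "Polynomial.coeff p i \<in> range of_rat" for i
  proof (cases "i < length P")
    case True
    then have "rev P ! i \<in> set P" by (metis length_rev nth_mem set_rev)
    then show ?thesis using set True by (auto simp: p_def nth_default_def)
  qed (auto simp: p_def nth_default_def intro: range_eqI[of _ _ 0])
  moreover have "p \<noteq> 0"
  proof
    assume "p = 0"
    then obtain n where "rev P = replicate n 0" by (auto simp: p_def Poly_eq_0)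
    then have "\<forall>c\<in>set P. c = 0" by (metis in_set_replicate set_rev)
    then show False using hd P(2) by auto
  qed
  moreover have "poly p x = 0" using P(3) by (simp add: type_ring_eval p_def)
  ultimately show ?thesis by blast
qed

text \<open>For \<open>d = 2 * j + 1\<close>, the element \<open>d / 2\<close> is outside
  \<open>A\<close> because it exceeds 1/2 by \<open>j\<close>. So \<open>2 / d\<close> lies in
  \<open>A\<close>, and \<open>1 / d = 1 - j * (2 / d)\<close>.\<close>

lemma odd_inverse_mem:
  fixes A :: "'b :: field_char_0 set"
  assumes A: "is_subring A" "inverse 2 \<notin> A" "\<And>x. x \<in> A \<or> inverse x \<in> A"
  shows "inverse (of_nat (2 * j + 1)) \<in> A"
proof -
  note Ad = is_subringD[OF A(1)]
  define d where "d = (of_nat (2 * j + 1) :: 'b)"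
  have d0: "d \<noteq> 0" unfolding d_def of_nat_eq_0_iff by simp
  have d: "d = 2 * of_nat j + 1" by (simp add: d_def)
  have j: "of_nat j \<in> A" by (rule is_subring_of_nat[OF A(1)])
  have "d / 2 \<notin> A"
  proof
    assume "d / 2 \<in> A"
    then have "d / 2 - of_nat j \<in> A" using Ad(4) j by blast
    moreover have "d / 2 - of_nat j = inverse 2" by (simp add: d field_simps)
    ultimately show False using A(2) by simp
  qed
  then have "inverse (d / 2) \<in> A" using A(3) by blast
  then have "1 - of_nat j * inverse (d / 2) \<in> A" using Ad(4)[OF Ad(1) Ad(6)[OF j]] by blast
  moreover have "1 - of_nat j * inverse (d / 2) = inverse d" using d0 by (simp add: field_simps) (simp add: d)
  ultimately show ?thesis by (simp add: d_def)
qed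

text \<open>The point is \<open>bounded\<close>. The ring \<open>B\<close> obtained from
  \<open>A\<close> by inverting 2 is a valuation ring containing the rationals; being integrally
  closed, it contains first the number field and then its closure.\<close>

theorem exists_dyadic_valuation_ring:
  assumes "number_field TYPE('a :: field_char_0)"
  shows "\<exists>V :: 'a alg_closure set. dyadic_valuation_ring V"
proof -
  obtain A :: "'a alg_closure set" where A: "is_subring A" "inverse 2 \<notin> A" "\<And>x. x \<in> A \<or> inverse x \<in> A"
    using exists_valuation_ring_two by blast
  note Ad = is_subringD[OF A(1)]
  have two: "2 ^ n \<in> A" for n by (intro is_subring_power[OF A(1)] is_subring_numeral[OF A(1)])
  define B where "B = {c. \<exists>n. 2 ^ n * c \<in> A}"
  have B: "is_subring B"
    unfolding is_subring_def
  proof (intro conjI ballI)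
    show "1 \<in> B" unfolding B_def using Ad by (auto intro: exI[of _ 0])
    fix x y assume "x \<in> B" "y \<in> B"
    then obtain n m where nm: "2 ^ n * x \<in> A" "2 ^ m * y \<in> A" by (auto simp: B_def)
    have "2 ^ m * (2 ^ n * x) - 2 ^ n * (2 ^ m * y) \<in> A" using nm two Ad(4,6) by blast
    then have "2 ^ (n + m) * (x - y) \<in> A" by (simp add: power_add algebra_simps)
    then show "x - y \<in> B" by (auto simp: B_def)
    have "(2 ^ n * x) * (2 ^ m * y) \<in> A" using nm Ad(6) by blast
    then have "2 ^ (n + m) * (x * y) \<in> A" by (simp add: power_add algebra_simps)
    then show "x * y \<in> B" by (auto simp: B_def)
  qed
  note Bd = is_subringD[OF B]
  have AB: "A \<subseteq> B" by (auto simp: B_def intro: exI[of _ 0])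
  have total: "x \<in> B \<or> inverse x \<in> B" for x using A(3)[of x] AB by blast
  have half: "inverse 2 \<in> B" unfolding B_def using Ad by (auto intro!: exI[of _ 1])
  have inv_nat: "inverse (of_nat n) \<in> B" for n
  proof (induction n rule: less_induct)
    case (less n)
    show ?case
    proof (cases "even n")
      case True
      then obtain j where j: "n = 2 * j" by (elim evenE)
      show ?thesis
      proof (cases "j = 0")
        case True
        then show ?thesis using j Bd by simp
      next
        case False
        then have "inverse (of_nat j) \<in> B" using less[of j] j by simp
        then have "inverse 2 * inverse (of_nat j) \<in> B" using half Bd(6) by blast
        then show ?thesis using j by simp
      qed
    next
      case False
      then obtain j where "n = 2 * j + 1" by (elim oddE)
      then show ?thesis using odd_inverse_mem[OF A, of j] AB by blast
    qed
  qed
  have rat: "of_rat r \<in> B" for r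
  proof (cases r)
    case (Fract a b)
    have int: "of_int a \<in> B"
    proof (cases a)
      case (nonneg n)
      then show ?thesis using is_subring_of_nat[OF B, of n] by simp
    next
      case (neg n)
      then show ?thesis using Bd(3)[OF is_subring_of_nat[OF B, of "Suc n"]] by simp
    qed
    have "inverse (of_int b) \<in> B" using inv_nat[of "nat b"] Fract by simp
    then have "of_int a * inverse (of_int b) \<in> B" using int Bd(6) by blast
    then show ?thesis using Fract by (simp add: of_rat_rat divide_inverse)
  qed
  have base: "to_ac x \<in> B" for x :: 'a
  proof -
    obtain p :: "'a poly" where p: "p \<noteq> 0" "\<forall>i. Polynomial.coeff p i \<in> range of_rat" "poly p x = 0"
      using number_field_algebraic[OF assms] by blast
    have cf: "\<exists>r. Polynomial.coeff p i = of_rat r" for i using p(2) by blast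
    show ?thesis
    proof (rule valuation_ring_integrally_closed[OF B total])
      show "map_poly to_ac p \<noteq> 0" using p(1) by (simp add: map_poly_eq_0_iff)
      show "Polynomial.coeff (map_poly to_ac p) i \<in> B" for i
        using cf[of i] rat by (auto simp: coeff_map_poly to_ac_of_rat)
      obtain r where "Polynomial.lead_coeff p = of_rat r" using cf by blast
      then have "inverse (Polynomial.lead_coeff (map_poly to_ac p)) = of_rat (inverse r)"
        by (simp add: degree_map_poly coeff_map_poly to_ac_of_rat of_rat_inverse)
      then show "inverse (Polynomial.lead_coeff (map_poly to_ac p)) \<in> B" using rat by metis
      show "poly (map_poly to_ac p) (to_ac x) = 0" using p(3) by (simp add: poly_map_poly_to_ac)
    qed
  qed
  have "x \<in> B" for x
  proof -
    obtain p :: "'a poly" where p: "p \<noteq> 0" "poly (map_poly to_ac p) x = 0" by (rule alg_closure_algebraic)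
    show ?thesis
    proof (rule valuation_ring_integrally_closed[OF B total _ _ _ p(2)])
      show "map_poly to_ac p \<noteq> 0" using p(1) by (simp add: map_poly_eq_0_iff)
      show "Polynomial.coeff (map_poly to_ac p) i \<in> B" for i using base by (simp add: coeff_map_poly)
      show "inverse (Polynomial.lead_coeff (map_poly to_ac p)) \<in> B"
        using base by (simp add: degree_map_poly coeff_map_poly flip: to_ac_inverse)
    qed
  qed
  then have "dyadic_valuation_ring A"
    unfolding dyadic_valuation_ring_def using A by (auto simp: B_def)
  then show ?thesis by blast
qed

section \<open>Infinitely many rational points\<close>

text \<open>The line \<open>z = 0\<close> meets the curve in \<open>[1:0:0]\<close> or in a root of
  \<open>f(s, 1, 0)\<close>, a polynomial of degree at most \<open>d\<close>. If that polynomial is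
  0, then \<open>[0:1:0]\<close> is a point over the base field.\<close>

lemma exists_point_of_bounded_degree:
  fixes f :: "'a :: field_char_0 poly3"
  assumes f: "homogeneous3 d f" "d > 0"
  shows "\<exists>E n x y. is_subfield E \<and> range to_ac \<subseteq> E \<and> n \<le> d \<and> ring.dimension type_ring n (range to_ac) E \<and>
    x \<in> E \<and> y \<in> E \<and> (x, y) \<noteq> (0, 0) \<and> eval3 f x y 0 = 0"
proof -
  interpret R: field "type_ring :: 'a alg_closure ring" by (rule field_from_type_algebra)
  have K: "is_subfield (range (to_ac :: 'a \<Rightarrow> _))" by (rule is_subfield_range_to_ac)
  have dim1: "R.dimension 1 (range to_ac) (range to_ac)"
    using R.dimension_one subfield_type_ring_iff K by blast
  define p where "p = line_poly f 0 1 0 1 0 0"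
  have p: "poly p s = eval3 f s 1 0" for s by (simp add: p_def poly_line_poly)
  consider "eval3 f 1 0 0 = 0" | "p = 0" | s where "p \<noteq> 0" "poly p s = 0"
    using homogeneous_form_vanishes_on_line[OF f, of 0 1 1 0 0 0] p by auto
  then show ?thesis
  proof cases
    case 1
    then show ?thesis using K dim1 is_subfieldD(1,2)[OF K] f(2)
      by (intro exI[of _ "range to_ac"] exI[of _ 1] exI[of _ 0]) auto
  next
    case 2
    then have "eval3 f 0 1 0 = 0" using p[of 0] by simp
    then show ?thesis using K dim1 is_subfieldD(1,2)[OF K] f(2)
      by (intro exI[of _ "range to_ac"] exI[of _ 1] exI[of _ 0]) auto
  next
    case (3 s)
    have "Polynomial.coeff p i \<in> range to_ac" for i
      unfolding p_def using K is_subfieldD(1,2)[OF K]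
      by (intro coeff_line_poly_mem) (auto simp: is_subfield_def)
    then obtain E n where E: "is_subfield E" "range to_ac \<subseteq> E" "s \<in> E" "n \<le> Polynomial.degree p"
        "R.dimension n (range to_ac) E"
      using exists_simple_extension[OF K 3(1) _ 3(2)] by blast
    moreover have "n \<le> d" using E(4) degree_line_poly[OF f(1)] unfolding p_def by (rule order.trans)
    ultimately show ?thesis using 3 p is_subfieldD(1)[OF E(1)]
      by (intro exI[of _ E] exI[of _ n] exI[of _ s] exI[of _ 1]) auto
  qed
qed

text \<open>The cross product of the normal vector with a coordinate vector is orthogonal to the
  normal. The coordinate vector is chosen according to whether \<open>x = 0\<close>, to ensure
  independence.\<close>

lemma exists_tangent_direction:
  assumes E: "is_subfield E" "x \<in> E" "y \<in> E" "n1 \<in> E" "n2 \<in> E" "n3 \<in> E"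
    and "(x, y) \<noteq> (0, 0)" "(n1, n2, n3) \<noteq> (0, 0, 0)" "x * n1 + y * n2 = 0"
  shows "\<exists>x'\<in>E. \<exists>y'\<in>E. \<exists>z'\<in>E. x' * n1 + y' * n2 + z' * n3 = 0 \<and> independent3 x y 0 x' y' z'"
proof -
  note Ed = is_subfieldD[OF E(1)]
  have n: "x * n1 = - (y * n2)" "y * n2 = - (x * n1)" using assms(9) by (simp_all add: eq_neg_iff_add_eq_0 add.commute)
  show ?thesis
  proof (cases "x = 0")
    case False
    have "independent3 x y 0 0 n3 (- n2)" using assms(8) False n by (auto simp: independent3_def)
    then show ?thesis using Ed E
      by (intro bexI[of _ 0] bexI[of _ n3] bexI[of _ "- n2"]) (auto simp: mult.commute)
  next
    case True
    have "independent3 x y 0 (- n3) 0 n1" using assms(7,8) True n by (auto simp: independent3_def)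
    then show ?thesis using Ed E
      by (intro bexI[of _ "- n3"] bexI[of _ 0] bexI[of _ n1]) (auto simp: mult.commute)
  qed
qed

lemma eval3_mem:
  assumes "is_subring F" "range to_ac \<subseteq> F" "x \<in> F" "y \<in> F" "z \<in> F"
  shows "eval3 f x y z \<in> F"
proof -
  have "eval3 f x y z = Polynomial.coeff (line_poly f x y z 0 0 0) 0"
    using poly_line_poly[of f x y z 0 0 0 0] by (simp add: poly_0_coeff_0)
  then show ?thesis using coeff_line_poly_mem[OF assms, of 0 0 0] is_subringD[OF assms(1)] by simp
qed

text \<open>By independence, different parameters give nonproportional triples, hence different
  classes, whichever square root is chosen as the last coordinate.\<close>

lemma infinite_rational_points_on_line:
  assumes L: "is_subfield L" "x \<in> L" "y \<in> L" "z \<in> L" "x' \<in> L" "y' \<in> L" "z' \<in> L"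
    and ind: "independent3 x y z x' y' z'"
    and inf: "infinite {s \<in> L. \<exists>w\<in>L. w\<^sup>2 = eval3 f (x + s * x') (y + s * y') (z + s * z')}" (is "infinite ?S")
  shows "infinite (rational_points f L)"
proof -
  note Ld = is_subfieldD[OF L(1)]
  define h where "h = (\<lambda>s. SOME w. w \<in> L \<and> w\<^sup>2 = eval3 f (x + s * x') (y + s * y') (z + s * z'))"
  have h: "h s \<in> L \<and> (h s)\<^sup>2 = eval3 f (x + s * x') (y + s * y') (z + s * z')" if "s \<in> ?S" for s
    unfolding h_def by (rule someI_ex) (use that in blast)
  define pt where "pt = (\<lambda>s. (x + s * x', y + s * y', z + s * z', h s))"
  have nz: "(x + s * x', y + s * y', z + s * z') \<noteq> (0, 0, 0)" for s
    using independent3_combination(1)[OF ind, of 1 s] by auto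
  have ptL: "x + s * x' \<in> L" "y + s * y' \<in> L" "z + s * z' \<in> L" if "s \<in> ?S" for s
    using that L Ld by auto
  define cls where "cls = (\<lambda>s. wproj_rel L `` {pt s})"
  have "cls ` ?S \<subseteq> rational_points f L"
  proof
    fix C assume "C \<in> cls ` ?S"
    then obtain s where s: "s \<in> ?S" "C = cls s" by blast
    show "C \<in> rational_points f L"
      unfolding rational_points_def s(2) cls_def pt_def
      by (rule quotientI) (use h[OF s(1)] ptL[OF s(1)] nz[of s] in auto)
  qed
  moreover have "inj_on cls ?S"
  proof (rule inj_onI)
    fix s r assume s: "s \<in> ?S" and r: "r \<in> ?S" and eq: "cls s = cls r"
    have "(pt r, pt r) \<in> wproj_rel L"
      unfolding wproj_rel_def pt_def using h[OF r] ptL[OF r] nz[of r] Ld(1)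
      by (intro CollectI exI[of _ "x + r * x'"] exI[of _ "y + r * y'"] exI[of _ "z + r * z'"] exI[of _ "h r"]
          exI[of _ 1]) auto
    then have "pt r \<in> cls r" unfolding cls_def by blast
    then have "pt r \<in> cls s" using eq by simp
    then obtain c where c: "x + r * x' = c * (x + s * x')" "y + r * y' = c * (y + s * y')" "z + r * z' = c * (z + s * z')"
      by (auto simp: cls_def wproj_rel_def pt_def)
    then have "(1 - c) * x + (r - c * s) * x' = 0" "(1 - c) * y + (r - c * s) * y' = 0" "(1 - c) * z + (r - c * s) * z' = 0"
      by (simp_all add: algebra_simps)
    from independent3_combination[OF ind this] show "s = r" by simp
  qed
  then have "infinite (cls ` ?S)" using inf finite_imageD by blast
  ultimately show ?thesis using infinite_super by blast
qed

theorem theorem1p1: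
  fixes f :: "'a :: field_char_0 poly3"
  assumes "number_field TYPE('a)"
    and "degree2_K3 f"
  shows "\<exists>L :: 'a alg_closure set.
           finite_extension L \<and> ext_degree L \<le> 12 \<and> infinite (rational_points f L)"
proof -
  obtain V :: "'a alg_closure set" where V: "dyadic_valuation_ring V"
    using exists_dyadic_valuation_ring[OF assms(1)] by blast
  have hom: "homogeneous3 6 f" and smooth: "smooth_plane_curve f"
    using assms(2) by (auto simp: degree2_K3_def)
  obtain E m x y where E: "is_subfield E" "range to_ac \<subseteq> E" "ring.dimension type_ring m (range to_ac) E" "m \<le> 6"
    and P: "x \<in> E" "y \<in> E" "(x, y) \<noteq> (0, 0)" "eval3 f x y 0 = 0"
    using exists_point_of_bounded_degree[OF hom] by auto
  note Ed = is_subfieldD[OF E(1)]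
  have Er: "is_subring E" using E(1) by (simp add: is_subfield_def)
  define n1 where "n1 = eval3 (pderiv_x f) x y 0"
  define n2 where "n2 = eval3 (pderiv_y f) x y 0"
  define n3 where "n3 = eval3 (pderiv_z f) x y 0"
  have nE: "n1 \<in> E" "n2 \<in> E" "n3 \<in> E"
    unfolding n1_def n2_def n3_def by (intro eval3_mem[OF Er E(2) P(1,2) Ed(2)])+
  have n0: "(n1, n2, n3) \<noteq> (0, 0, 0)"
    using smooth P(3,4) unfolding smooth_plane_curve_def n1_def n2_def n3_def by force
  \<comment> \<open>Euler's identity puts the point on its own tangent line, as needed to find a
    second vector spanning that line.\<close>
  have "x * n1 + y * n2 = 0"
    using euler_identity[OF hom, of x y 0] P(4) by (simp add: n1_def n2_def)
  then obtain x' y' z' where D: "x' \<in> E" "y' \<in> E" "z' \<in> E" "x' * n1 + y' * n2 + z' * n3 = 0"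
    and ind: "independent3 x y 0 x' y' z'"
    using exists_tangent_direction[OF E(1) P(1,2) nE P(3) n0] by blast
  define H where "H = line_poly f x y 0 x' y' z'"
  have H0: "Polynomial.coeff H 0 = 0"
    using poly_line_poly[of f x y 0 x' y' z' 0] P(4) by (simp add: H_def poly_0_coeff_0)
  have H1: "Polynomial.coeff H 1 = 0"
    using coeff_1_line_poly[of f x y 0 x' y' z'] D(4) by (simp add: H_def n1_def n2_def n3_def)
  obtain g where g: "H = pCons 0 (pCons 0 g)"
    using H0 H1 by (metis coeff_pCons_0 coeff_pCons_Suc One_nat_def pCons_cases)
  have gs: "eval3 f (x + s * x') (y + s * y') (0 + s * z') = s\<^sup>2 * poly g s" for s
    using poly_line_poly[of f x y 0 x' y' z' s] by (simp add: g power2_eq_square mult.assoc flip: H_def)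
  have "H \<noteq> 0" unfolding H_def
    by (rule smooth_curve_contains_no_line[where d = 5]) (use hom smooth ind in simp_all)
  then have gnz: "g \<noteq> 0" by (auto simp: g)
  have "Polynomial.degree H \<le> 6" unfolding H_def by (rule degree_line_poly[OF hom])
  then have gdeg: "Polynomial.degree g \<le> 4" using gnz by (simp add: g)
  have "Polynomial.coeff g i = Polynomial.coeff H (Suc (Suc i))" for i by (simp add: g)
  then have gE: "Polynomial.coeff g i \<in> E" for i
    unfolding H_def using coeff_line_poly_mem[OF Er E(2) P(1,2) Ed(2) D(1-3)] by simp
  obtain t where t: "t \<in> E" and inf: "\<And>L q. is_subfield L \<Longrightarrow> E \<subseteq> L \<Longrightarrow> q \<in> L \<Longrightarrow> q\<^sup>2 = poly g t \<Longrightarrow>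
      infinite {s \<in> L. \<exists>v\<in>L. v\<^sup>2 = poly g s}"
    using infinite_squares_over_quadratic_extension[OF V gnz gdeg gE E(1)] by blast
  obtain q where q: "q\<^sup>2 = poly g t" using nth_root_exists[of 2 "poly g t"] by auto
  \<comment> \<open>\<open>r\<close> is reducible when \<open>q\<close> already lies in
    \<open>E\<close>; in either case the degree \<open>n\<close> is at most 2.\<close>
  define r where "r = [:- poly g t, 0, 1:]"
  have "poly g t \<in> E" unfolding poly_altdef using gE t by (intro is_subring_sum[OF Er] Ed)
  then have r: "r \<noteq> 0" "\<And>i. Polynomial.coeff r i \<in> E" "poly r q = 0"
    using Ed(1-3) q by (auto simp: r_def coeff_pCons power2_eq_square split: nat.splits)
  obtain L n where L: "is_subfield L" "E \<subseteq> L" "q \<in> L" "n \<le> Polynomial.degree r" "ring.dimension type_ring n E L"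
    using exists_simple_extension[OF E(1) r] by blast
  have ext: "finite_extension L" "ext_degree L = m * n"
    using finite_extension_tower[OF E(1-3) L(1,2,5)] by auto
  have "n \<le> 2" using L(4) by (simp add: r_def)
  then have "ext_degree L \<le> 6 * 2" unfolding ext(2) using E(4) by (intro mult_le_mono)
  \<comment> \<open>A point of \<open>v^2 = g(s)\<close> lifts to the surface by
    \<open>w = s * v\<close>, since the sextic restricts to \<open>s^2 g(s)\<close>.\<close>
  moreover have "{s \<in> L. \<exists>v\<in>L. v\<^sup>2 = poly g s}
      \<subseteq> {s \<in> L. \<exists>w\<in>L. w\<^sup>2 = eval3 f (x + s * x') (y + s * y') (0 + s * z')}"
  proof
    fix s assume "s \<in> {s \<in> L. \<exists>v\<in>L. v\<^sup>2 = poly g s}"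
    then obtain v where v: "s \<in> L" "v \<in> L" "v\<^sup>2 = poly g s" by blast
    then have "(s * v)\<^sup>2 = eval3 f (x + s * x') (y + s * y') (0 + s * z')"
      unfolding gs by (simp add: power_mult_distrib)
    moreover have "s * v \<in> L" using v is_subfieldD(6)[OF L(1)] by blast
    ultimately show "s \<in> {s \<in> L. \<exists>w\<in>L. w\<^sup>2 = eval3 f (x + s * x') (y + s * y') (0 + s * z')}"
      using v(1) by blast
  qed
  then have "infinite {s \<in> L. \<exists>w\<in>L. w\<^sup>2 = eval3 f (x + s * x') (y + s * y') (0 + s * z')}"
    using inf[OF L(1-3) q] infinite_super by blast
  then have "infinite (rational_points f L)"
    using P(1,2) D(1-3) Ed(2) L(2)
    by (intro infinite_rational_points_on_line[OF L(1) _ _ _ _ _ _ ind]) auto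
  ultimately show ?thesis using ext(1) by auto
qed

end
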